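(* Let $A$ be a sequentially monotone complete $C^*$-algebra, $\mathcal J\vartriangleleft A$ a (closed) two-sided ideal and $Q\simeq A/\mathcal J$ the $C^*$-quotient. Let $\{x_n\}_{n\in\mathbb N}\subseteq Q$ be a bounded monotone increasing sequence (of selfadjoint elements) and let $\{y_l\}_{l\in\mathbb N}\subseteq Q$ be a countable collection with $y_l\ge x_n$ for all $n,l$. Then there exists $z\in Q$ with $$x_n\le x_{n+1}\le\cdots\le z\le y_l\qquad\text{for all } n,\,l\in\mathbb N .$$ In particular, if $Q$ admits an order isomorphic representation on a separable Hilbert space, then $Q$ is sequentially monotone complete.
   Context: A $C^*$-algebra is sequentially monotone complete (a $\Sigma_\omega$-algebra) if every bounded monotone increasing sequence of selfadjoint elements has a least upper bound in the selfadjoint part. An order isomorphic representation of $Q$ on a Hilbert space $\mathcal H$ is a map $\iota:Q^{sa}\to\mathcal B(\mathcal H)^{sa}$ (not required to be multiplicative or linear) with $x\le y\iff\iota(x)\le\iota(y)$. *)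

theory Defs
  imports "HOL-Analysis.Analysis" "HOL-Library.Set_Algebras"
begin

class scaleC = scaleR +
  fixes scaleC :: "complex \<Rightarrow> 'a \<Rightarrow> 'a"  (infixr "*\<^sub>C" 75)
  assumes scaleR_scaleC: "r *\<^sub>R x = complex_of_real r *\<^sub>C x"

class complex_normed_vector = scaleC + real_normed_vector +
  assumes scaleC_add_right: "c *\<^sub>C (x + y) = c *\<^sub>C x + c *\<^sub>C y"
    and scaleC_add_left: "(c + d) *\<^sub>C x = c *\<^sub>C x + d *\<^sub>C x"
    and scaleC_scaleC: "c *\<^sub>C (d *\<^sub>C x) = (c * d) *\<^sub>C x"
    and norm_scaleC: "norm (c *\<^sub>C x) = cmod c * norm x"

text \<open>C*-algebras are not assumed to be unital, and the zero algebra is allowed.\<close>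

class cstar_algebra = complex_normed_vector + real_normed_algebra + complete_space +
  fixes star :: "'a \<Rightarrow> 'a"
  assumes mult_scaleC_left: "(c *\<^sub>C x) * y = c *\<^sub>C (x * y)"
    and mult_scaleC_right: "x * (c *\<^sub>C y) = c *\<^sub>C (x * y)"
    and star_star: "star (star x) = x"
    and star_add: "star (x + y) = star x + star y"
    and star_scaleC: "star (c *\<^sub>C x) = cnj c *\<^sub>C star x"
    and star_mult: "star (x * y) = star y * star x"
    and cstar_identity: "norm (star x * x) = (norm x)\<^sup>2"

definition selfadjoint :: "'a::cstar_algebra \<Rightarrow> bool" where
  "selfadjoint x \<longleftrightarrow> star x = x"

definition cstar_pos :: "'a::cstar_algebra \<Rightarrow> bool" where
  "cstar_pos x \<longleftrightarrow> (\<exists>b. x = star b * b)"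

definition cstar_le :: "'a::cstar_algebra \<Rightarrow> 'a \<Rightarrow> bool"  (infix "\<sqsubseteq>" 50) where
  "x \<sqsubseteq> y \<longleftrightarrow> cstar_pos (y - x)"

definition bounded_increasing_sa :: "(nat \<Rightarrow> 'a::cstar_algebra) \<Rightarrow> bool" where
  "bounded_increasing_sa x \<longleftrightarrow>
     (\<forall>n. selfadjoint (x n)) \<and> bounded (range x) \<and> (\<forall>n. x n \<sqsubseteq> x (Suc n))"

definition is_sa_lub :: "(nat \<Rightarrow> 'a::cstar_algebra) \<Rightarrow> 'a \<Rightarrow> bool" where
  "is_sa_lub x s \<longleftrightarrow> selfadjoint s \<and> (\<forall>n. x n \<sqsubseteq> s) \<and>
     (\<forall>u. selfadjoint u \<and> (\<forall>n. x n \<sqsubseteq> u) \<longrightarrow> s \<sqsubseteq> u)"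

definition seq_monotone_complete :: "'a::cstar_algebra itself \<Rightarrow> bool" where
  "seq_monotone_complete (_ :: 'a itself) \<longleftrightarrow>
     (\<forall>x :: nat \<Rightarrow> 'a. bounded_increasing_sa x \<longrightarrow> (\<exists>s. is_sa_lub x s))"

definition closed_ideal :: "'a::cstar_algebra set \<Rightarrow> bool" where
  "closed_ideal J \<longleftrightarrow> closed J \<and> 0 \<in> J \<and> (\<forall>x\<in>J. \<forall>y\<in>J. x + y \<in> J) \<and>
     (\<forall>c. \<forall>x\<in>J. c *\<^sub>C x \<in> J) \<and> (\<forall>a. \<forall>x\<in>J. a * x \<in> J \<and> x * a \<in> J)"

text \<open>
  The quotient by J: its elements are the cosets \<open>a +o J\<close>. The operations are unions over
  representatives, which makes them independent of choices; for a closed ideal J these unions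
  are again single cosets.
\<close>

definition quot_carrier :: "'a::cstar_algebra set \<Rightarrow> 'a set set" where
  "quot_carrier J = range (\<lambda>a. a +o J)"

definition quot_add :: "'a::cstar_algebra set \<Rightarrow> 'a set \<Rightarrow> 'a set \<Rightarrow> 'a set" where
  "quot_add J U V = (\<Union>u\<in>U. \<Union>v\<in>V. (u + v) +o J)"

definition quot_mult :: "'a::cstar_algebra set \<Rightarrow> 'a set \<Rightarrow> 'a set \<Rightarrow> 'a set" where
  "quot_mult J U V = (\<Union>u\<in>U. \<Union>v\<in>V. (u * v) +o J)"

definition quot_scaleC :: "'a::cstar_algebra set \<Rightarrow> complex \<Rightarrow> 'a set \<Rightarrow> 'a set" where
  "quot_scaleC J c U = (\<Union>u\<in>U. (c *\<^sub>C u) +o J)"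

definition quot_star :: "'a::cstar_algebra set \<Rightarrow> 'a set \<Rightarrow> 'a set" where
  "quot_star J U = (\<Union>u\<in>U. star u +o J)"

definition quot_norm :: "'a::cstar_algebra set \<Rightarrow> real" where
  "quot_norm U = (INF u\<in>U. norm u)"

text \<open>An isomorphism of C*-algebras from the type \<open>'q\<close> onto the quotient by J.\<close>

definition quot_iso :: "'a::cstar_algebra set \<Rightarrow> ('q::cstar_algebra \<Rightarrow> 'a set) \<Rightarrow> bool" where
  "quot_iso J \<phi> \<longleftrightarrow> bij_betw \<phi> UNIV (quot_carrier J) \<and>
     (\<forall>p q. \<phi> (p + q) = quot_add J (\<phi> p) (\<phi> q)) \<and>
     (\<forall>p q. \<phi> (p * q) = quot_mult J (\<phi> p) (\<phi> q)) \<and>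
     (\<forall>c q. \<phi> (c *\<^sub>C q) = quot_scaleC J c (\<phi> q)) \<and>
     (\<forall>q. \<phi> (star q) = quot_star J (\<phi> q)) \<and>
     (\<forall>q. norm q = quot_norm (\<phi> q))"

text \<open>Hilbert spaces; the inner product is linear in the second argument.\<close>

class chilbert_space = complex_normed_vector + complete_space +
  fixes cinner :: "'a \<Rightarrow> 'a \<Rightarrow> complex"
  assumes cinner_commute: "cinner x y = cnj (cinner y x)"
    and cinner_add_right: "cinner x (y + z) = cinner x y + cinner x z"
    and cinner_scaleC_right: "cinner x (c *\<^sub>C y) = c * cinner x y"
    and cinner_self: "cinner x x = complex_of_real ((norm x)\<^sup>2)"

text \<open>The library's bounded operators are only real-linear, hence the first conjunct.\<close>

definition sa_operators :: "('h::chilbert_space \<Rightarrow>\<^sub>L 'h) set" where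
  "sa_operators = {T. (\<forall>c x. blinfun_apply T (c *\<^sub>C x) = c *\<^sub>C blinfun_apply T x) \<and>
     (\<forall>x y. cinner (blinfun_apply T x) y = cinner x (blinfun_apply T y))}"

definition operator_le :: "('h::chilbert_space \<Rightarrow>\<^sub>L 'h) \<Rightarrow> ('h \<Rightarrow>\<^sub>L 'h) \<Rightarrow> bool" where
  "operator_le S T \<longleftrightarrow> (\<forall>x. cinner x (blinfun_apply (T - S) x) \<in> \<real>\<^sub>\<ge>\<^sub>0)"

text \<open>Only the values of \<open>\<iota>\<close> on selfadjoint elements matter.\<close>

definition order_isomorphic_rep ::
  "('q::cstar_algebra \<Rightarrow> ('h::chilbert_space \<Rightarrow>\<^sub>L 'h)) \<Rightarrow> bool" where
  "order_isomorphic_rep \<iota> \<longleftrightarrow>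
     (\<forall>x. selfadjoint x \<longrightarrow> \<iota> x \<in> sa_operators) \<and>
     (\<forall>x y. selfadjoint x \<and> selfadjoint y \<longrightarrow> (x \<sqsubseteq> y \<longleftrightarrow> operator_le (\<iota> x) (\<iota> y)))"

end

theory Submission
  imports Defs
begin

text \<open>
  The \<open>x n\<close> are lifted successively to an increasing sequence \<open>a n\<close>, together with lifts of the \<open>y l\<close>,
  so that \<open>a n\<close> stays below the finitely many lifts chosen so far; \<open>z\<close> is the image of the supremum of
  the \<open>a n\<close>. Since several upper bounds \<open>q l\<close> of a positive \<open>p\<close> modulo \<open>J\<close> do not commute, \<open>p\<close> cannot
  be pushed below all of them exactly, but averages of \<open>(1 - e) p (1 - e)\<close> over approximate units
  \<open>e\<close> of \<open>J\<close> lie below every \<open>q l\<close> up to an arbitrarily small error. The errors are made summable, and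
  every \<open>y l\<close> is treated infinitely often with ever smaller errors, so they vanish in the limit.

  On a separable Hilbert space the quadratic forms of countably many upper bounds of a sequence have
  the same lower bounds as those of all its upper bounds. An element between the sequence and these
  countably many upper bounds is therefore its supremum.
\<close>

text \<open>The statement takes positive to mean of the form \<open>star b * b\<close>, which is not
  visibly closed under sums or limits, and no unit is at hand. Positivity is therefore traded for a
  norm condition, that left multiplication by t - a has norm at most t. Square roots from a
  norm-convergent iteration then stand in for the functional calculus and identify the two notions.
  The projection onto the quotient preserves order but not suprema. Hence \<open>z\<close> can only
  be compared with \<open>y l\<close> if some upper bound of all the \<open>a n\<close> in the
  algebra maps close to \<open>y l\<close>. The \<open>a n\<close> have to increase, so an error is
  never repaired by lowering them but by raising the lifts of the \<open>y l\<close>; summable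
  errors make these lifts converge in norm. Each stage takes in finitely many \<open>y l\<close>,
  because approximate units control only finitely many elements of the ideal at once.\<close>

instance cstar_algebra \<subseteq> banach ..

section \<open>Elementary consequences of the C*-identity\<close>

lemma star_scaleR [simp]: "star (r *\<^sub>R x) = r *\<^sub>R star (x :: 'a::cstar_algebra)"
  by (simp add: scaleR_scaleC star_scaleC)

lemma star_zero [simp]: "star (0 :: 'a::cstar_algebra) = 0"
  using star_scaleR[of 0 "0::'a"] by simp

lemma star_minus [simp]: "star (- x) = - star (x :: 'a::cstar_algebra)"
  using star_scaleR[of "-1" x] by simp

lemma star_diff [simp]: "star (x - y) = star x - star (y :: 'a::cstar_algebra)"
  using star_add[of x "- y"] by simp

lemmas [simp] = star_star star_add star_mult

lemma norm_star_le: "norm x \<le> norm (star (x :: 'a::cstar_algebra))"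
proof (cases "x = 0")
  case False
  have "norm x * norm x \<le> norm (star x) * norm x"
    using cstar_identity[of x] norm_mult_ineq[of "star x" x] by (simp add: power2_eq_square)
  then show ?thesis using False by simp
qed simp

lemma norm_star [simp]: "norm (star x) = norm (x :: 'a::cstar_algebra)"
  using norm_star_le[of x] norm_star_le[of "star x"] by simp

lemma bounded_linear_star: "bounded_linear (star :: 'a::cstar_algebra \<Rightarrow> 'a)"
  by (rule bounded_linear_intro[of _ 1]) auto

lemmas tendsto_star [tendsto_intros] = bounded_linear.tendsto[OF bounded_linear_star]

lemma norm_mult_star: "norm (x * star x) = (norm (x :: 'a::cstar_algebra))\<^sup>2"
  using cstar_identity[of "star x"] by simp

lemma star_mult_eq_0: "star x * x = 0 \<Longrightarrow> x = (0 :: 'a::cstar_algebra)"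
  using cstar_identity[of x] by simp

lemma selfadjoint_square_eq_0: "selfadjoint x \<Longrightarrow> x * x = 0 \<Longrightarrow> x = (0 :: 'a::cstar_algebra)"
  using star_mult_eq_0[of x] by (simp add: selfadjoint_def)

lemma norm_selfadjoint_square: "selfadjoint x \<Longrightarrow> norm (x * x) = (norm (x :: 'a::cstar_algebra))\<^sup>2"
  using cstar_identity[of x] by (simp add: selfadjoint_def)

lemma selfadjoint_0 [simp]: "selfadjoint (0 :: 'a::cstar_algebra)"
  and selfadjoint_minus: "selfadjoint x \<Longrightarrow> selfadjoint (- x :: 'a::cstar_algebra)"
  and selfadjoint_add: "selfadjoint x \<Longrightarrow> selfadjoint y \<Longrightarrow> selfadjoint (x + y :: 'a::cstar_algebra)"
  and selfadjoint_diff: "selfadjoint x \<Longrightarrow> selfadjoint y \<Longrightarrow> selfadjoint (x - y :: 'a::cstar_algebra)"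
  and selfadjoint_scaleR: "selfadjoint x \<Longrightarrow> selfadjoint (r *\<^sub>R x :: 'a::cstar_algebra)"
  and selfadjoint_mult: "selfadjoint x \<Longrightarrow> selfadjoint y \<Longrightarrow> x * y = y * x \<Longrightarrow>
    selfadjoint (x * y :: 'a::cstar_algebra)"
  and selfadjoint_star_mult: "selfadjoint (star z * z :: 'a::cstar_algebra)"
  by (simp_all add: selfadjoint_def mult.assoc)

lemma selfadjoint_limit:
  assumes "X \<longlonglongrightarrow> (x :: 'a::cstar_algebra)" and "\<And>n. selfadjoint (X n)"
  shows "selfadjoint x"
proof -
  have "(\<lambda>n. star (X n)) = X"
    using assms(2) by (simp add: selfadjoint_def)
  then have "X \<longlonglongrightarrow> star x"
    using tendsto_star[OF assms(1)] by simp
  from LIMSEQ_unique[OF this assms(1)] show ?thesis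
    by (simp add: selfadjoint_def)
qed

section \<open>Bounds for left multiplication in the unitization\<close>

text \<open>The pair \<open>(l, a)\<close> stands for the element \<open>l + a\<close> of the unitization, and
  the operator norm of its left multiplication on the algebra takes the role of its norm.\<close>

definition mult_bound :: "real \<Rightarrow> 'a::cstar_algebra \<Rightarrow> real \<Rightarrow> bool" where
  "mult_bound l a C \<longleftrightarrow> (\<forall>b. norm (l *\<^sub>R b + a * b) \<le> C * norm b)"

lemma mult_boundD: "mult_bound l a C \<Longrightarrow> norm (l *\<^sub>R b + a * b) \<le> C * norm b"
  by (simp add: mult_bound_def)

lemma mult_bound_norm: "mult_bound 0 a (norm a)"
  by (simp add: mult_bound_def norm_mult_ineq)

lemma mult_bound_scalar: "mult_bound l 0 \<bar>l\<bar>"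
  by (simp add: mult_bound_def)

lemma mult_bound_mono: "mult_bound l a C \<Longrightarrow> C \<le> D \<Longrightarrow> mult_bound l a D"
  unfolding mult_bound_def by (meson mult_right_mono norm_ge_zero order_trans)

lemma mult_bound_add:
  assumes "mult_bound l a C" "mult_bound m b D"
  shows "mult_bound (l + m) (a + b) (C + D)"
  unfolding mult_bound_def
proof
  fix x
  have "norm ((l *\<^sub>R x + a * x) + (m *\<^sub>R x + b * x)) \<le> C * norm x + D * norm x"
    by (rule norm_triangle_mono) (use assms in \<open>auto simp: mult_bound_def\<close>)
  then show "norm ((l + m) *\<^sub>R x + (a + b) * x) \<le> (C + D) * norm x"
    by (simp add: algebra_simps)
qed

lemma mult_bound_scale:
  assumes "mult_bound l a C"
  shows "mult_bound (r * l) (r *\<^sub>R a) (\<bar>r\<bar> * C)"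
  unfolding mult_bound_def
proof
  fix x
  have "norm (r *\<^sub>R (l *\<^sub>R x + a * x)) \<le> \<bar>r\<bar> * (C * norm x)"
    using mult_boundD[OF assms] by (simp add: mult_left_mono)
  then show "norm ((r * l) *\<^sub>R x + r *\<^sub>R a * x) \<le> \<bar>r\<bar> * C * norm x"
    by (simp add: algebra_simps)
qed

lemma mult_bound_mult:
  assumes "mult_bound l a C" "mult_bound m b D" "0 \<le> C"
  shows "mult_bound (l * m) (l *\<^sub>R b + m *\<^sub>R a + a * b) (C * D)"
  unfolding mult_bound_def
proof
  fix x
  have "norm (l *\<^sub>R (m *\<^sub>R x + b * x) + a * (m *\<^sub>R x + b * x)) \<le> C * norm (m *\<^sub>R x + b * x)"
    by (rule mult_boundD[OF assms(1)])
  also have "\<dots> \<le> C * (D * norm x)"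
    using mult_boundD[OF assms(2)] assms(3) by (simp add: mult_left_mono)
  finally show "norm ((l * m) *\<^sub>R x + (l *\<^sub>R b + m *\<^sub>R a + a * b) * x) \<le> C * D * norm x"
    by (simp add: algebra_simps)
qed

text \<open>Without a unit to test on, the scalar is moved to the right-hand side and the remaining
  left multiplication is tested on \<open>star a\<close>, where the C*-identity is sharp.\<close>

lemma mult_bound_imp_norm_le:
  assumes "mult_bound l a C" and "0 \<le> C"
  shows "norm a \<le> C + \<bar>l\<bar>"
proof (cases "a = 0")
  case False
  have "mult_bound 0 a (C + \<bar>l\<bar>)"
    using mult_bound_add[OF assms(1) mult_bound_scalar[of "-l"]] by simp
  from mult_boundD[OF this, of "star a"] have "norm a * norm a \<le> (C + \<bar>l\<bar>) * norm a"
    by (simp add: norm_mult_star power2_eq_square)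
  with False show ?thesis by simp
qed (use assms in simp)

lemma mult_bound_limit:
  assumes "l \<longlonglongrightarrow> l'" "a \<longlonglongrightarrow> a'" "C \<longlonglongrightarrow> C'" and "\<And>n. mult_bound (l n) (a n) (C n)"
  shows "mult_bound l' a' C'"
  unfolding mult_bound_def
proof
  fix b
  have "(\<lambda>n. norm (l n *\<^sub>R b + a n * b)) \<longlonglongrightarrow> norm (l' *\<^sub>R b + a' * b)"
    by (intro tendsto_intros assms)
  moreover have "(\<lambda>n. C n * norm b) \<longlonglongrightarrow> C' * norm b"
    by (intro tendsto_intros assms)
  ultimately show "norm (l' *\<^sub>R b + a' * b) \<le> C' * norm b"
    by (rule LIMSEQ_le) (use mult_boundD[OF assms(4)] in auto)
qed

section \<open>Square roots\<close>

text \<open>The iteration \<open>w \<mapsto> (T + w\<^sup>2) / 2\<close> from \<open>w = 0\<close> tends to \<open>1 - sqrt (1 - T)\<close> whenever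
  \<open>T\<close> is a contraction, because it is dominated by the same iteration for \<open>T = 1\<close>. Here it
  is run on \<open>T = t + c\<close> in the unitization, separately on the scalar part and the rest.\<close>

primrec root_iter_scalar :: "real \<Rightarrow> nat \<Rightarrow> real" where
  "root_iter_scalar t 0 = 0"
| "root_iter_scalar t (Suc n) = (t + (root_iter_scalar t n)\<^sup>2) / 2"

primrec root_iter :: "real \<Rightarrow> 'a::cstar_algebra \<Rightarrow> nat \<Rightarrow> 'a" where
  "root_iter t c 0 = 0"
| "root_iter t c (Suc n) =
    (1/2) *\<^sub>R (c + (2 * root_iter_scalar t n) *\<^sub>R root_iter t c n + root_iter t c n * root_iter t c n)"

lemma root_iter_scalar_0 [simp]: "root_iter_scalar 0 n = 0"
  by (induction n) auto

lemma root_iter_scalar_1_bounds: "0 \<le> root_iter_scalar 1 n \<and> root_iter_scalar 1 n \<le> 1"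
proof (induction n)
  case (Suc n)
  then have "(root_iter_scalar 1 n)\<^sup>2 \<le> 1"
    by (simp add: power_le_one)
  then show ?case by simp
qed simp

lemma root_iter_scalar_1_mono: "root_iter_scalar 1 n \<le> root_iter_scalar 1 (Suc n)"
  using sum_squares_bound[of 1 "root_iter_scalar 1 n"] by (simp add: field_simps)

lemma root_iter_scalar_1_limit: "root_iter_scalar 1 \<longlonglongrightarrow> 1"
proof -
  have "incseq (root_iter_scalar 1)"
    using root_iter_scalar_1_mono by (rule incseq_SucI)
  then obtain L where L: "root_iter_scalar 1 \<longlonglongrightarrow> L"
    using root_iter_scalar_1_bounds by (metis incseq_convergent)
  have "(\<lambda>n. root_iter_scalar 1 (Suc n)) \<longlonglongrightarrow> (1 + L\<^sup>2) / 2"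
    unfolding root_iter_scalar.simps by (intro tendsto_intros L) simp
  with L have "L = (1 + L\<^sup>2) / 2"
    using LIMSEQ_unique LIMSEQ_Suc by blast
  then have "(L - 1)\<^sup>2 = 0"
    by (simp add: power2_eq_square algebra_simps)
  with L show ?thesis by simp
qed

text \<open>Taking \<open>c' = c\<close> gives commutation; the version with two different elements
  is what Kaplansky's argument for \<open>star b * b\<close> requires.\<close>

lemma root_iter_intertwine:
  "c * d = d * c' \<Longrightarrow> root_iter t c n * d = d * root_iter t c' n"
proof (induction n)
  case (Suc n)
  then have "root_iter t c n * (root_iter t c n * d) = d * (root_iter t c' n * root_iter t c' n)"
    by (metis mult.assoc)
  with Suc show ?case by (simp add: distrib_left distrib_right mult.assoc)
qed simp

lemma root_iter_commute: "root_iter t c n * root_iter t c m = root_iter t c m * root_iter t c n"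
  by (rule root_iter_intertwine, rule sym, rule root_iter_intertwine) simp

lemma selfadjoint_root_iter: "selfadjoint c \<Longrightarrow> selfadjoint (root_iter t c n)"
  by (induction n) (simp_all add: selfadjoint_def)

lemma mult_bound_root_iter:
  assumes "mult_bound t c 1"
  shows "mult_bound (root_iter_scalar t n) (root_iter t c n) (root_iter_scalar 1 n)"
proof (induction n)
  case 0
  then show ?case by (simp add: mult_bound_def)
next
  case (Suc n)
  let ?m = "root_iter_scalar t n" and ?u = "root_iter t c n" and ?o = "root_iter_scalar 1 n"
  have "mult_bound (?m * ?m) (?m *\<^sub>R ?u + ?m *\<^sub>R ?u + ?u * ?u) (?o * ?o)"
    using Suc root_iter_scalar_1_bounds by (blast intro: mult_bound_mult)
  from mult_bound_scale[OF mult_bound_add[OF assms this], of "1/2"] show ?case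
    by (simp add: power2_eq_square scaleR_2 flip: scaleR_scaleR add.assoc)
qed

text \<open>For commuting iterates w and v the next increment is (w - v)(w + v)/2. The scalar
  iteration for T = 1 obeys the same identity, so its increments dominate by induction.\<close>

lemma mult_bound_root_iter_diff:
  assumes "mult_bound t c 1"
  shows "mult_bound (root_iter_scalar t (Suc n) - root_iter_scalar t n)
    (root_iter t c (Suc n) - root_iter t c n) (root_iter_scalar 1 (Suc n) - root_iter_scalar 1 n)"
proof (induction n)
  case 0
  from mult_bound_scale[OF assms, of "1/2"] show ?case by simp
next
  case (Suc n)
  define m u o' where "m = root_iter_scalar t n" and "u = root_iter t c n"
    and "o' = root_iter_scalar 1 n"
  define m1 u1 o1 where "m1 = root_iter_scalar t (Suc n)" and "u1 = root_iter t c (Suc n)"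
    and "o1 = root_iter_scalar 1 (Suc n)"
  have comm: "u * u1 = u1 * u"
    unfolding u_def u1_def by (rule root_iter_commute)
  have d: "mult_bound (m1 - m) (u1 - u) (o1 - o')"
    using Suc by (simp only: m_def u_def o'_def m1_def u1_def o1_def)
  have s: "mult_bound (m1 + m) (u1 + u) (o1 + o')"
    unfolding m_def u_def o'_def m1_def u1_def o1_def
    by (intro mult_bound_add mult_bound_root_iter assms)
  have "0 \<le> o1 - o'"
    using root_iter_scalar_1_mono by (simp add: o'_def o1_def del: root_iter_scalar.simps)
  from mult_bound_scale[OF mult_bound_mult[OF d s this], of "1/2"]
  have "mult_bound ((m1\<^sup>2 - m\<^sup>2) / 2)
    ((1/2) *\<^sub>R ((2 * m1) *\<^sub>R u1 + u1 * u1 - ((2 * m) *\<^sub>R u + u * u))) ((o1\<^sup>2 - o'\<^sup>2) / 2)"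
    by (simp add: algebra_simps diff_divide_distrib power2_eq_square comm scaleR_2 flip: scaleR_scaleR)
  moreover have "root_iter_scalar s (Suc (Suc k)) - root_iter_scalar s (Suc k)
      = ((root_iter_scalar s (Suc k))\<^sup>2 - (root_iter_scalar s k)\<^sup>2) / 2" for s k
    by (simp add: field_simps)
  moreover have "root_iter t c (Suc (Suc n)) - root_iter t c (Suc n)
      = (1/2) *\<^sub>R ((2 * m1) *\<^sub>R u1 + u1 * u1 - ((2 * m) *\<^sub>R u + u * u))"
    unfolding root_iter.simps(2)[of t c "Suc n"] unfolding u1_def[symmetric]
    by (subst (2) u1_def) (simp add: m_def u_def m1_def algebra_simps del: root_iter_scalar.simps)
  ultimately show ?case
    by (simp only: m_def o'_def m1_def o1_def)
qed

definition root_limit :: "real \<Rightarrow> 'a::cstar_algebra \<Rightarrow> 'a" where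
  "root_limit t c = lim (root_iter t c)"

text \<open>The expected limit 1 - sqrt (1 - t) equals t exactly for t = 0 and t = 1.\<close>

lemma root_iter_scalar_limit: "t \<in> {0, 1} \<Longrightarrow> root_iter_scalar t \<longlonglongrightarrow> t"
  using root_iter_scalar_1_limit by (auto simp: fun_eq_iff intro: Lim_transform_eventually[OF tendsto_const])

lemma root_iter_limit:
  assumes "mult_bound t c 1" "t \<in> {0, 1}"
  shows "root_iter t c \<longlonglongrightarrow> root_limit t c"
proof -
  let ?d = "\<lambda>n. root_iter_scalar 1 (Suc n) - root_iter_scalar 1 n"
  have "summable ?d"
    by (rule telescope_summable[OF root_iter_scalar_1_limit])
  then have "summable (\<lambda>n. 2 * ?d n)"
    by (rule summable_mult)
  \<comment> \<open>One copy of the increment bounds the element of the unitization, the other its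
    scalar part.\<close>
  moreover have "norm (root_iter t c (Suc n) - root_iter t c n) \<le> 2 * ?d n" for n
  proof -
    have d: "0 \<le> ?d n" using root_iter_scalar_1_mono[of n] by simp
    have "\<bar>root_iter_scalar t (Suc n) - root_iter_scalar t n\<bar> \<le> ?d n"
      using assms(2) d by (auto simp del: root_iter_scalar.simps(2) intro: order_trans)
    with mult_bound_imp_norm_le[OF mult_bound_root_iter_diff[OF assms(1)] d]
    have "norm (root_iter t c (Suc n) - root_iter t c n) \<le> ?d n + ?d n"
      by (blast intro: order_trans add_left_mono)
    then show ?thesis by (simp only: mult_2)
  qed
  ultimately have "summable (\<lambda>n. root_iter t c (Suc n) - root_iter t c n)"
    by (rule summable_comparison_test'[of _ 0])
  then have "convergent (root_iter t c)"
    by (simp add: summable_iff_convergent sum_lessThan_telescope del: root_iter.simps(2))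
  then show ?thesis
    by (simp add: root_limit_def convergent_LIMSEQ_iff)
qed

lemma root_limit_eq:
  assumes "mult_bound t c 1" "t \<in> {0, 1}"
  shows "2 *\<^sub>R root_limit t c = c + (2 * t) *\<^sub>R root_limit t c + root_limit t c * root_limit t c"
proof -
  note lims = root_iter_limit[OF assms] root_iter_scalar_limit[OF assms(2)]
  have "(\<lambda>n. root_iter t c (Suc n)) \<longlonglongrightarrow>
      (1/2) *\<^sub>R (c + (2 * t) *\<^sub>R root_limit t c + root_limit t c * root_limit t c)"
    unfolding root_iter.simps by (intro tendsto_intros lims)
  then have "root_limit t c = (1/2) *\<^sub>R (c + (2 * t) *\<^sub>R root_limit t c + root_limit t c * root_limit t c)"
    using LIMSEQ_unique LIMSEQ_Suc[OF lims(1)] by blast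
  from arg_cong[OF this, of "\<lambda>x. 2 *\<^sub>R x"] show ?thesis by simp
qed

lemma mult_bound_root_limit:
  assumes "mult_bound t c 1" "t \<in> {0, 1}"
  shows "mult_bound t (root_limit t c) 1"
  using mult_bound_limit[OF root_iter_scalar_limit[OF assms(2)] root_iter_limit[OF assms]
      root_iter_scalar_1_limit mult_bound_root_iter[OF assms(1)]] .

lemma root_limit_intertwine:
  assumes "mult_bound t c 1" "mult_bound t c' 1" "t \<in> {0, 1}" "c * d = d * c'"
  shows "root_limit t c * d = d * root_limit t c'"
proof -
  have "(\<lambda>n. root_iter t c n * d) \<longlonglongrightarrow> root_limit t c * d"
    by (intro tendsto_intros root_iter_limit assms)
  moreover have "(\<lambda>n. root_iter t c n * d) \<longlonglongrightarrow> d * root_limit t c'"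
    unfolding root_iter_intertwine[OF assms(4)] by (intro tendsto_intros root_iter_limit assms)
  ultimately show ?thesis by (rule LIMSEQ_unique)
qed

lemma selfadjoint_root_limit:
  "mult_bound t c 1 \<Longrightarrow> t \<in> {0, 1} \<Longrightarrow> selfadjoint c \<Longrightarrow> selfadjoint (root_limit t c)"
  using selfadjoint_limit[OF root_iter_limit] selfadjoint_root_iter by blast

text \<open>The case \<open>t = 0\<close> gives a square root of \<open>1 - c\<close>, of the form \<open>1 - w\<close>.\<close>

lemma complement_root:
  fixes c :: "'a::cstar_algebra"
  assumes "selfadjoint c" "norm c \<le> 1"
  obtains w where "selfadjoint w" "2 *\<^sub>R w - w * w = c" "\<And>d. c * d = d * c \<Longrightarrow> w * d = d * w"
proof
  have b: "mult_bound 0 c 1"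
    using mult_bound_norm assms(2) by (rule mult_bound_mono)
  show "selfadjoint (root_limit 0 c)"
    using b assms(1) by (simp add: selfadjoint_root_limit)
  show "2 *\<^sub>R root_limit 0 c - root_limit 0 c * root_limit 0 c = c"
    using root_limit_eq[OF b] by simp
  show "root_limit 0 c * d = d * root_limit 0 c" if "c * d = d * c" for d
    using root_limit_intertwine[OF b b _ that] by simp
qed

text \<open>For T = 1 - a the iteration tends to 1 - sqrt a, whose algebra part is - sqrt a. The
  root thus lies in the algebra itself.\<close>

definition small_root :: "'a::cstar_algebra \<Rightarrow> 'a" where
  "small_root a = - root_limit 1 (- a)"

lemma small_root_square: "mult_bound 1 (- a) 1 \<Longrightarrow> small_root a * small_root a = a"
  using root_limit_eq[of 1 "- a"] by (simp add: small_root_def)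

lemma selfadjoint_small_root: "mult_bound 1 (- a) 1 \<Longrightarrow> selfadjoint a \<Longrightarrow> selfadjoint (small_root a)"
  by (simp add: small_root_def selfadjoint_minus selfadjoint_root_limit)

lemma mult_bound_small_root: "mult_bound 1 (- a) 1 \<Longrightarrow> mult_bound 1 (- small_root a) 1"
  by (simp add: small_root_def mult_bound_root_limit)

lemma small_root_intertwine:
  "mult_bound 1 (- a) 1 \<Longrightarrow> mult_bound 1 (- a') 1 \<Longrightarrow> a * d = d * a' \<Longrightarrow>
    small_root a * d = d * small_root a'"
  using root_limit_intertwine[of 1 "- a" "- a'" d] by (simp add: small_root_def)

lemma scaleC_zero_right [simp]: "c *\<^sub>C (0 :: 'a::complex_normed_vector) = 0"
  using scaleC_add_right[of c "0::'a" 0] by simp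

lemma scaleC_minus_right [simp]: "c *\<^sub>C (- x) = - (c *\<^sub>C (x :: 'a::complex_normed_vector))"
  using scaleC_add_right[of c x "- x"] by (simp add: eq_neg_iff_add_eq_0 add.commute)

lemma scaleC_diff_right: "c *\<^sub>C (x - y) = c *\<^sub>C x - c *\<^sub>C (y :: 'a::complex_normed_vector)"
  using scaleC_add_right[of c x "- y"] by simp

lemma scaleC_minus_left [simp]: "(- c) *\<^sub>C x = - (c *\<^sub>C (x :: 'a::complex_normed_vector))"
proof -
  have "0 *\<^sub>C x = 0"
    using scaleR_scaleC[of 0 x] by simp
  then show ?thesis
    using scaleC_add_left[of c "- c" x] by (simp add: eq_neg_iff_add_eq_0 add.commute)
qed

lemma scaleC_ii [simp]: "\<i> *\<^sub>C \<i> *\<^sub>C x = - (x :: 'a::complex_normed_vector)"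
  using scaleR_scaleC[of "-1" x] by (simp add: scaleC_scaleC)

section \<open>Positivity\<close>

text \<open>Since \<open>(1 + u)\<^sup>2 + k\<^sup>2 = 1\<close>, the elements \<open>1 + u \<plusminus> i k\<close> of the unitization are unitary,
  and \<open>1 + u\<close> is their mean.\<close>

lemma mult_bound_cosine:
  fixes u k :: "'a::cstar_algebra"
  assumes "selfadjoint u" "selfadjoint k" "u * k = k * u" "2 *\<^sub>R u + u * u + k * k = 0"
  shows "mult_bound 1 u 1"
  unfolding mult_bound_def
proof
  fix b :: 'a
  have u: "star u = u" and k: "star k = k"
    using assms(1,2) by (auto simp: selfadjoint_def)
  have kk: "k * k = - (2 *\<^sub>R u + u * u)"
    unfolding eq_neg_iff_add_eq_0 using assms(4) by (simp add: add.commute)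
  define p v where "p = b + u * b" and "v = \<i> *\<^sub>C (k * b)"
  have sv: "star v = - (\<i> *\<^sub>C (star b * k))" and sp: "star p = star b + star b * u"
    by (simp_all add: v_def p_def star_scaleC u k)
  have vv: "star v * v = star b * (k * k) * b"
    unfolding sv unfolding v_def
    by (simp only: mult_scaleC_left mult_scaleC_right minus_mult_left[symmetric] scaleC_ii mult.assoc
        scaleC_minus_right minus_minus)
  have pp: "star p * p = star b * b + star b * (2 *\<^sub>R u + u * u) * b"
    unfolding sp by (simp add: p_def algebra_simps scaleR_2)
  have "star p * v = \<i> *\<^sub>C (star b * k * b + star b * (u * k) * b)"
    unfolding sp by (simp add: v_def mult_scaleC_right scaleC_add_right algebra_simps)
  moreover have "star v * p = - (\<i> *\<^sub>C (star b * k * b + star b * (k * u) * b))"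
    unfolding sv by (simp add: p_def mult_scaleC_left scaleC_add_right algebra_simps)
  ultimately have pv: "star p * v + star v * p = 0"
    using assms(3) by simp
  have s: "star p * p + star v * v = star b * b"
    unfolding pp vv kk by (simp only: mult_minus_left mult_minus_right add.assoc right_minus add_0_right)
  have "star (p + v) * (p + v) = (star p * p + star v * v) + (star p * v + star v * p)"
    by (simp add: algebra_simps)
  then have 1: "norm (p + v) = norm b"
    using cstar_identity[of "p + v"] cstar_identity[of b] by (simp add: s pv)
  have "star (p - v) * (p - v) = (star p * p + star v * v) - (star p * v + star v * p)"
    by (simp add: algebra_simps)
  then have 2: "norm (p - v) = norm b"
    using cstar_identity[of "p - v"] cstar_identity[of b] by (simp add: s pv)
  have "2 *\<^sub>R p = (p + v) + (p - v)"
    by (simp add: scaleR_2)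
  then have "norm (2 *\<^sub>R p) \<le> norm (p + v) + norm (p - v)"
    by (metis norm_triangle_ineq)
  then have "norm p \<le> norm b"
    by (simp add: 1 2)
  then show "norm (1 *\<^sub>R b + u * b) \<le> 1 * norm b"
    by (simp add: p_def)
qed

text \<open>With 1 - w the root of 1 - k^2, the elements 1 - w and k are a cosine and a sine. Hence
  1 - w is a contraction, and so is its square 1 - k^2.\<close>

lemma mult_bound_complement_square:
  fixes k :: "'a::cstar_algebra"
  assumes "selfadjoint k" "norm k \<le> 1"
  shows "mult_bound 1 (- (k * k)) 1"
proof -
  have "norm (k * k) \<le> 1"
    using assms by (simp add: norm_selfadjoint_square power_le_one)
  moreover have "selfadjoint (k * k)"
    using assms by (simp add: selfadjoint_mult)
  ultimately obtain w where w: "selfadjoint w" "2 *\<^sub>R w - w * w = k * k"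
      "\<And>d. k * k * d = d * (k * k) \<Longrightarrow> w * d = d * w"
    by (blast elim: complement_root)
  have "w * k = k * w"
    by (rule w(3)) (rule mult.assoc)
  then have "mult_bound 1 (- w) 1"
    by (intro mult_bound_cosine[of _ k]) (simp_all add: assms w(1) selfadjoint_minus flip: w(2))
  from mult_bound_mult[OF this this] show ?thesis
    by (simp flip: w(2) add: scaleR_2 algebra_simps)
qed

text \<open>A norm bound t on t - a confines the spectrum of a to [0, 2t]. In this form closure
  under sums is just the triangle inequality.\<close>

definition nonneg :: "'a::cstar_algebra \<Rightarrow> bool" where
  "nonneg a \<longleftrightarrow> selfadjoint a \<and> (\<exists>t>0. mult_bound t (- a) t)"

lemma nonneg_selfadjoint: "nonneg a \<Longrightarrow> selfadjoint a"
  by (simp add: nonneg_def)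

lemma nonneg_add: "nonneg a \<Longrightarrow> nonneg b \<Longrightarrow> nonneg (a + b)"
  unfolding nonneg_def using mult_bound_add[of _ "- a" _ _ "- b"]
  by (metis add_pos_pos minus_add_distrib add.commute selfadjoint_add)

lemma nonneg_scaleR: "nonneg a \<Longrightarrow> 0 < r \<Longrightarrow> nonneg (r *\<^sub>R a)"
  unfolding nonneg_def using mult_bound_scale[of _ "- a" _ r]
  by (metis abs_of_pos mult_pos_pos scaleR_minus_right selfadjoint_scaleR)

lemma mult_bound_square:
  fixes k :: "'a::cstar_algebra"
  assumes "selfadjoint k" "norm (k * k) \<le> t" "0 < t"
  shows "mult_bound t (- (k * k)) t"
proof -
  let ?k = "(1 / sqrt t) *\<^sub>R k"
  have "(norm k)\<^sup>2 \<le> t"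
    using assms by (simp add: norm_selfadjoint_square)
  then have "norm ?k \<le> 1"
    using assms(3) by (simp add: real_le_rsqrt)
  then have "mult_bound 1 (- (?k * ?k)) 1"
    by (simp add: assms selfadjoint_scaleR mult_bound_complement_square del: mult_scaleR_left mult_scaleR_right)
  from mult_bound_scale[OF this, of t] show ?thesis
    using assms(3) by simp
qed

lemma nonneg_square:
  assumes "selfadjoint k"
  shows "nonneg (k * k)"
proof -
  have "0 < norm (k * k) + 1"
    by (simp add: add_nonneg_pos)
  then show ?thesis
    using mult_bound_square[OF assms, of "norm (k * k) + 1"] assms
    by (auto simp: nonneg_def selfadjoint_mult)
qed

lemma nonneg_0 [simp]: "nonneg 0"
  using nonneg_square[of 0] by simp

lemma nonneg_root:
  assumes "nonneg a"
  shows "\<exists>k. selfadjoint k \<and> k * k = a \<and> (\<forall>d. a * d = d * a \<longrightarrow> k * d = d * k)"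
proof -
  obtain t where t: "0 < t" "mult_bound t (- a) t" "selfadjoint a"
    using assms by (auto simp: nonneg_def)
  have b: "mult_bound 1 (- ((1/t) *\<^sub>R a)) 1"
    using mult_bound_scale[OF t(2), of "1/t"] t(1) by simp
  let ?k = "sqrt t *\<^sub>R small_root ((1/t) *\<^sub>R a)"
  have "selfadjoint ?k"
    using t b by (simp add: selfadjoint_scaleR selfadjoint_small_root)
  moreover have "?k * ?k = a"
    using t by (simp add: small_root_square[OF b])
  moreover have "?k * d = d * ?k" if "a * d = d * a" for d
    using small_root_intertwine[OF b b, of d] that by simp
  ultimately show ?thesis by blast
qed

text \<open>The t in the definition of \<open>nonneg\<close> may depend on \<open>a\<close>. Passing
  through a root of \<open>a\<close> allows any positive t above the norm, so a convergent sequence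
  gets one common t.\<close>

lemma nonneg_mult_bound: "nonneg a \<Longrightarrow> norm a \<le> t \<Longrightarrow> 0 < t \<Longrightarrow> mult_bound t (- a) t"
  by (metis mult_bound_square nonneg_root)

lemma nonneg_limit:
  assumes "X \<longlonglongrightarrow> a" and "\<And>n. nonneg (X n)"
  shows "nonneg a"
proof -
  have "Bseq X"
    using assms(1) by (simp add: convergentI convergent_imp_Bseq)
  then obtain t where t: "0 < t" "\<And>n. norm (X n) \<le> t"
    by (auto simp: Bseq_def)
  then have "mult_bound t (- X n) t" for n
    by (simp add: assms(2) nonneg_mult_bound)
  then have "mult_bound t (- a) t"
    using mult_bound_limit[OF tendsto_const tendsto_minus[OF assms(1)] tendsto_const] by blast
  then show ?thesis
    using t(1) selfadjoint_limit[OF assms(1)] assms(2) by (auto simp: nonneg_def)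
qed

text \<open>Commuting \<open>k\<close> and \<open>m\<close> with \<open>k\<^sup>2 + m\<^sup>2 = 0\<close> combine to \<open>N = k + i m\<close> with \<open>N\<^sup>* N = 0\<close>.\<close>

lemma nonneg_antisym:
  fixes a :: "'a::cstar_algebra"
  assumes "nonneg a" "nonneg (- a)"
  shows "a = 0"
proof -
  obtain k where k: "selfadjoint k" "k * k = a" "\<And>d. a * d = d * a \<Longrightarrow> k * d = d * k"
    using assms(1) by (blast dest: nonneg_root)
  obtain m where m: "selfadjoint m" "m * m = - a" "\<And>d. (- a) * d = d * (- a) \<Longrightarrow> m * d = d * m"
    using assms(2) by (blast dest: nonneg_root)
  have km: "m * k = k * m"
    by (rule m(3)) (simp flip: k(2) add: mult.assoc)
  have sk: "star k = k" and sm: "star m = m"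
    using k(1) m(1) by (auto simp: selfadjoint_def)
  have "star (k + \<i> *\<^sub>C m) * (k + \<i> *\<^sub>C m) = 0"
    by (simp add: star_scaleC sk sm distrib_left distrib_right mult_scaleC_left mult_scaleC_right
        scaleC_add_right km k(2) m(2) left_diff_distrib right_diff_distrib)
  then have "k = - (\<i> *\<^sub>C m)"
    unfolding eq_neg_iff_add_eq_0 by (rule star_mult_eq_0)
  then have "star k = \<i> *\<^sub>C m"
    by (simp add: star_scaleC sm)
  with \<open>k = - (\<i> *\<^sub>C m)\<close> have "k = - k"
    by (metis sk)
  then have "2 *\<^sub>R k = 0"
    by (simp add: scaleR_2 eq_neg_iff_add_eq_0)
  with k(2) show ?thesis by simp
qed

lemma sum_squares_eq_0:
  assumes "selfadjoint x" "selfadjoint y" "x * x + y * y = (0 :: 'a::cstar_algebra)"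
  shows "x = 0"
proof -
  have "y * y = - (x * x)"
    unfolding eq_neg_iff_add_eq_0 using assms(3) by (simp add: add.commute)
  then have "x * x = 0"
    using nonneg_antisym[of "x * x"] nonneg_square[OF assms(1)] nonneg_square[OF assms(2)] by simp
  with assms(1) show ?thesis by (rule selfadjoint_square_eq_0)
qed

section \<open>Uniqueness of positive roots and positivity of \<open>star b * b\<close>\<close>

lemma nonneg_small_root: "mult_bound 1 (- a) 1 \<Longrightarrow> selfadjoint a \<Longrightarrow> nonneg (small_root a)"
  using mult_bound_small_root by (auto simp: nonneg_def selfadjoint_small_root intro!: exI[of _ 1])

text \<open>The two roots r and f commute, so h = r - f satisfies (r + f) h = 0. Writing r = p^2 and
  f = q^2 turns (r + f) h^2 = 0 into a vanishing sum of the squares of p h and q h, whence r h = f h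
  = 0 and h^2 = 0.\<close>

lemma small_root_of_square:
  fixes f :: "'a::cstar_algebra"
  assumes "nonneg f" "norm f \<le> 1"
  shows "small_root (f * f) = f"
proof -
  have f: "selfadjoint f"
    using assms(1) by (rule nonneg_selfadjoint)
  have b: "mult_bound 1 (- (f * f)) 1"
    using f assms(2) by (rule mult_bound_complement_square)
  define r where "r = small_root (f * f)"
  have rr: "r * r = f * f"
    unfolding r_def using b by (rule small_root_square)
  have rf: "r * f = f * r"
    unfolding r_def using b b by (rule small_root_intertwine) (simp add: mult.assoc)
  have r: "nonneg r"
    unfolding r_def using b by (rule nonneg_small_root) (simp add: f selfadjoint_mult)
  define h where "h = r - f"
  have h: "selfadjoint h"
    using r f by (simp add: h_def selfadjoint_diff nonneg_selfadjoint)
  obtain p where p: "selfadjoint p" "p * p = r" "\<And>d. r * d = d * r \<Longrightarrow> p * d = d * p"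
    using r by (blast dest: nonneg_root)
  obtain q where q: "selfadjoint q" "q * q = f" "\<And>d. f * d = d * f \<Longrightarrow> q * d = d * q"
    using assms(1) by (blast dest: nonneg_root)
  have "r * h = h * r" "f * h = h * f"
    by (simp_all add: h_def rf algebra_simps)
  then have ph: "p * h = h * p" and qh: "q * h = h * q"
    using p(3) q(3) by blast+
  have "(p * h) * (p * h) = r * h * h" "(q * h) * (q * h) = f * h * h"
    by (metis p(2) ph mult.assoc) (metis q(2) qh mult.assoc)
  then have "(p * h) * (p * h) + (q * h) * (q * h) = (r + f) * h * h"
    by (simp add: distrib_right)
  also have "(r + f) * h = 0"
    by (simp add: h_def algebra_simps rr rf)
  finally have eq: "(p * h) * (p * h) + (q * h) * (q * h) = 0"
    by simp
  have ph': "selfadjoint (p * h)" and qh': "selfadjoint (q * h)"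
    using p(1) q(1) h ph qh by (blast intro: selfadjoint_mult)+
  have "p * h = 0"
    using ph' qh' eq by (rule sum_squares_eq_0)
  moreover have "q * h = 0"
    using qh' ph' eq[unfolded add.commute[of "p * h * (p * h)"]] by (rule sum_squares_eq_0)
  ultimately have "r * h = 0" "f * h = 0"
    by (simp_all add: mult.assoc flip: p(2) q(2))
  then have "h * h = 0"
    by (simp add: h_def left_diff_distrib)
  with h have "h = 0" by (rule selfadjoint_square_eq_0)
  then show ?thesis by (simp add: h_def r_def)
qed

text \<open>Kaplansky's argument. With \<open>c = b\<^sup>* b\<close>, \<open>r = |c|\<close> and \<open>d = b (r - c)\<close> one has
  \<open>d\<^sup>* d = - g\<close> with \<open>g \<ge> 0\<close>, and \<open>f = d d\<^sup>*\<close> is positive because \<open>d d\<^sup>* + d\<^sup>* d\<close> is.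
  As \<open>f\<^sup>2 d = d g\<^sup>2\<close>, uniqueness of positive roots gives \<open>f d = d g\<close>, while \<open>f d = - d g\<close>.\<close>

lemma nonneg_star_mult_small:
  fixes b :: "'a::cstar_algebra"
  assumes "norm b \<le> 1/2"
  shows "nonneg (star b * b)"
proof -
  define c where "c = star b * b"
  have c: "selfadjoint c" and sc: "star c = c"
    by (simp_all add: c_def selfadjoint_star_mult selfadjoint_def)
  \<comment> \<open>The bound 1/2 on \<open>b\<close> is chosen so that \<open>c\<close>,
    \<open>h\<close>, \<open>d\<close>, \<open>f\<close> and \<open>g\<close> all stay in the unit
    ball, where \<open>small_root\<close> of their squares is available.\<close>
  have "norm c \<le> (1/2)\<^sup>2"
    unfolding c_def cstar_identity using assms by (intro power_mono) auto
  then have nc: "norm c \<le> 1/4"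
    by (simp add: power2_eq_square)
  then have bc: "mult_bound 1 (- (c * c)) 1"
    using c by (intro mult_bound_complement_square) auto
  define r where "r = small_root (c * c)"
  have rr: "r * r = c * c"
    unfolding r_def using bc by (rule small_root_square)
  have rc: "r * c = c * r"
    unfolding r_def using bc bc by (rule small_root_intertwine) (rule mult.assoc)
  have r: "nonneg r"
    unfolding r_def using bc by (rule nonneg_small_root) (simp add: c selfadjoint_mult)
  then have sr: "selfadjoint r"
    by (rule nonneg_selfadjoint)
  then have "(norm r)\<^sup>2 = (norm c)\<^sup>2"
    using c rr by (simp flip: norm_selfadjoint_square)
  then have "norm r = norm c"
    by simp
  obtain p where p: "selfadjoint p" "p * p = r" "\<And>d. r * d = d * r \<Longrightarrow> p * d = d * p"
    using r by (blast dest: nonneg_root)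
  define h where "h = r - c"
  have h: "selfadjoint h" and sh: "star h = h"
    using sr c by (simp_all add: h_def selfadjoint_def)
  have "r * h = h * r"
    by (simp add: h_def rc algebra_simps)
  then have ph: "p * h = h * p"
    by (rule p(3))
  then have sph: "selfadjoint (p * h)"
    using p(1) h by (intro selfadjoint_mult)
  define g where "g = (p * h) * (p * h)"
  have g: "nonneg g"
    unfolding g_def using sph by (rule nonneg_square)
  have g_eq: "g = h * r * h"
    unfolding g_def by (metis p(2) ph mult.assoc)
  define d where "d = b * h"
  have hc: "h * c = - (h * r)"
    by (simp add: h_def rc rr left_diff_distrib)
  have dd: "star d * d = - g"
  proof -
    have "star d * d = h * c * h"
      by (simp add: d_def sh c_def mult.assoc)
    then show ?thesis
      by (simp add: g_eq hc)
  qed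
  have "norm h \<le> 1/2"
    using norm_triangle_ineq4[of r c] nc \<open>norm r = norm c\<close> by (simp add: h_def)
  then have "norm b * norm h \<le> 1/2 * (1/2)"
    using assms by (intro mult_mono) auto
  then have nd: "norm d \<le> 1"
    using norm_mult_ineq[of b h] by (simp add: d_def)
  then have nd2: "(norm d)\<^sup>2 \<le> 1"
    by (simp add: power_le_one)
  then have ng: "norm g \<le> 1"
    using cstar_identity[of d] by (simp add: dd)
  define f where "f = d * star d"
  have nf: "norm f \<le> 1"
    using nd2 by (simp add: f_def norm_mult_star)
  have f: "nonneg f"
  proof -
    \<comment> \<open>Up to scaling these are the real and imaginary parts of \<open>d\<close>; half
      the sum of their squares is \<open>d * star d + star d * d\<close>, that is
      \<open>f - g\<close>.\<close>
    define q1 q2 where "q1 = d + star d" and "q2 = \<i> *\<^sub>C (d - star d)"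
    have "selfadjoint q1" "selfadjoint q2"
      by (simp_all add: q1_def q2_def selfadjoint_def star_scaleC scaleC_diff_right)
    then have "nonneg ((1/2) *\<^sub>R (q1 * q1 + q2 * q2) + g)"
      by (intro nonneg_add nonneg_scaleR nonneg_square g) auto
    moreover have "q2 * q2 = - ((d - star d) * (d - star d))"
      by (simp only: q2_def mult_scaleC_left mult_scaleC_right scaleC_ii)
    then have "q1 * q1 + q2 * q2 = 2 *\<^sub>R f - 2 *\<^sub>R g"
      by (simp add: q1_def f_def dd scaleR_2 algebra_simps)
    ultimately show ?thesis
      by (simp add: scaleR_diff_right)
  qed
  have fd: "f * d = - (d * g)"
    by (simp add: f_def mult.assoc dd)
  then have "f * f * d = - (f * d * g)"
    by (metis mult.assoc mult_minus_right)
  then have "f * f * d = d * (g * g)"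
    by (simp add: fd mult.assoc)
  then have "small_root (f * f) * d = d * small_root (g * g)"
    using f g nf ng
    by (intro small_root_intertwine mult_bound_complement_square) (auto simp: nonneg_selfadjoint)
  then have "f * d = d * g"
    using f g nf ng by (simp add: small_root_of_square)
  with fd have "2 *\<^sub>R (d * g) = 0"
    by (simp add: scaleR_2 eq_neg_iff_add_eq_0)
  then have "d * g = 0"
    by simp
  moreover have "g * g = - (star d * (d * g))"
    by (simp add: dd flip: mult.assoc)
  ultimately have "g * g = 0"
    by simp
  \<comment> \<open>Vanishing of \<open>g\<close> gives r (r - c) = 0, and with r^2 = c^2 this
    forces c = r, which is positive.\<close>
  with g have "g = 0"
    by (blast intro: selfadjoint_square_eq_0 nonneg_selfadjoint)
  then have "p * h = 0"
    using sph by (simp only: g_def selfadjoint_square_eq_0)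
  then have "r * h = 0"
    by (metis p(2) mult.assoc mult_zero_right)
  then have "r * r = r * c"
    by (simp add: h_def right_diff_distrib)
  then have "h * h = 0"
    using rc rr by (simp add: h_def left_diff_distrib right_diff_distrib)
  with h have "h = 0"
    by (rule selfadjoint_square_eq_0)
  with r show ?thesis
    by (simp add: h_def c_def)
qed

lemma nonneg_star_mult: "nonneg (star b * (b :: 'a::cstar_algebra))"
proof (cases "b = 0")
  case False
  define b' where "b' = (1 / (2 * norm b)) *\<^sub>R b"
  have "norm b' \<le> 1/2"
    using False by (simp add: b'_def)
  then have "nonneg ((2 * norm b)\<^sup>2 *\<^sub>R (star b' * b'))"
    using False by (intro nonneg_scaleR nonneg_star_mult_small) auto
  then show ?thesis
    using False by (simp add: b'_def power2_eq_square)
qed simp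

lemma cstar_pos_iff_nonneg: "cstar_pos a \<longleftrightarrow> nonneg a"
  unfolding cstar_pos_def using nonneg_star_mult nonneg_root by (metis selfadjoint_def)

section \<open>Order estimates: conjugation, monotonicity of the norm, absolute values\<close>

lemma nonneg_conj:
  assumes "nonneg a"
  shows "nonneg (star z * a * z)"
proof -
  obtain k where k: "selfadjoint k" "k * k = a"
    using assms by (blast dest: nonneg_root)
  have "star z * a * z = star (k * z) * (k * z)"
    using k(1) by (simp add: selfadjoint_def mult.assoc flip: k(2))
  then show ?thesis
    by (simp only: nonneg_star_mult)
qed

text \<open>This is x \<le> M conjugated by z, so that M needs no unit. It holds because M - x = M
  (1 - w)^2 for the root 1 - w of 1 - x/M.\<close>

lemma nonneg_norm_conj:
  fixes x :: "'a::cstar_algebra"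
  assumes "selfadjoint x" "norm x \<le> M" "0 < M"
  shows "nonneg (M *\<^sub>R (star z * z) - star z * x * z)"
proof -
  have "norm ((1/M) *\<^sub>R x) \<le> 1"
    using assms by simp
  then obtain w where w: "selfadjoint w" "2 *\<^sub>R w - w * w = (1/M) *\<^sub>R x"
    using complement_root assms(1) selfadjoint_scaleR by metis
  have "star (z - w * z) * (z - w * z) = star z * z - star z * (2 *\<^sub>R w - w * w) * z"
    using w(1) by (simp add: selfadjoint_def algebra_simps scaleR_2)
  then have "M *\<^sub>R (star z * z) - star z * x * z = M *\<^sub>R (star (z - w * z) * (z - w * z))"
    unfolding w(2) using assms(3) by (simp add: scaleR_diff_right)
  then show ?thesis
    using assms(3) by (simp only: nonneg_scaleR nonneg_star_mult)
qed

text \<open>Conjugating x \<le> y \<le> s by the root of x, where s is the norm of y, gives x^2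
  \<le> s x. So z = x/s has a root m of z - z^2, and (1 - 2z)^2 + (2m)^2 = 1 makes 1 - 2z a
  contraction.\<close>

lemma nonneg_norm_mono:
  fixes x y :: "'a::cstar_algebra"
  assumes "nonneg x" "nonneg (y - x)"
  shows "norm x \<le> norm y"
proof (cases "y = 0")
  case True
  then show ?thesis using assms nonneg_antisym by simp
next
  case False
  define s where "s = norm y"
  have s: "0 < s" using False by (simp add: s_def)
  obtain k where k: "selfadjoint k" "k * k = x"
    using assms(1) by (blast dest: nonneg_root)
  then have sk: "star k = k" by (simp add: selfadjoint_def)
  have "selfadjoint y"
    using selfadjoint_add[of "y - x" x] assms by (simp add: nonneg_selfadjoint)
  then have "nonneg (s *\<^sub>R (star k * k) - star k * y * k + star k * (y - x) * k)"
    using s assms(2) by (intro nonneg_add nonneg_conj nonneg_norm_conj) (auto simp: s_def)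
  also have "s *\<^sub>R (star k * k) - star k * y * k + star k * (y - x) * k = s *\<^sub>R x - x * x"
    by (simp add: sk algebra_simps flip: k(2))
  finally have 1: "nonneg (s *\<^sub>R x - x * x)" .
  define z where "z = (1/s) *\<^sub>R x"
  have z: "selfadjoint z"
    using assms(1) by (simp add: z_def selfadjoint_scaleR nonneg_selfadjoint)
  have "nonneg ((1/s\<^sup>2) *\<^sub>R (s *\<^sub>R x - x * x))"
    using 1 s by (simp add: nonneg_scaleR)
  also have "(1/s\<^sup>2) *\<^sub>R (s *\<^sub>R x - x * x) = z - z * z"
    using s by (simp add: z_def scaleR_diff_right power2_eq_square)
  finally obtain m where m: "selfadjoint m" "m * m = z - z * z"
      "\<And>d. (z - z * z) * d = d * (z - z * z) \<Longrightarrow> m * d = d * m"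
    by (blast dest: nonneg_root)
  have "m * z = z * m"
    by (rule m(3)) (simp add: algebra_simps)
  then have "mult_bound 1 (- (2 *\<^sub>R z)) 1"
    using z m(1)
    by (intro mult_bound_cosine[of _ "2 *\<^sub>R m"])
       (simp_all add: selfadjoint_minus selfadjoint_scaleR m(2) scaleR_diff_right)
  from mult_bound_add[OF this mult_bound_scalar[of "-1"]] have "mult_bound 0 (- (2 *\<^sub>R z)) 2"
    by simp
  from mult_bound_imp_norm_le[OF this] have "norm z \<le> 1"
    by simp
  then show ?thesis
    using s by (simp add: z_def) (simp add: s_def)
qed

text \<open>The witness is r = sqrt (c^2). That m = r - c is positive needs an argument: m^2 = 2 r
  m, and with n = sqrt (m^2) and z = n - m one finds (z m)^2 = - 2 r n z^2. The right-hand side is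
  minus a square as r, n and z commute, so z m = 0, then z = 0 and m = n.\<close>

lemma absolute_value_ex:
  fixes c :: "'a::cstar_algebra"
  assumes c: "selfadjoint c"
  shows "\<exists>r. nonneg r \<and> nonneg (r - c) \<and> norm r = norm c"
proof -
  have small: "\<exists>r. nonneg r \<and> nonneg (r - c) \<and> norm r = norm c"
    if c: "selfadjoint c" and nc: "norm c \<le> 1/2" for c :: 'a
  proof -
    have bc: "mult_bound 1 (- (c * c)) 1"
      using c nc by (intro mult_bound_complement_square) auto
    define r where "r = small_root (c * c)"
    have rr: "r * r = c * c"
      unfolding r_def using bc by (rule small_root_square)
    have rc: "r * c = c * r"
      unfolding r_def using bc bc by (rule small_root_intertwine) (rule mult.assoc)
    have r: "nonneg r"
      unfolding r_def using bc by (rule nonneg_small_root) (simp add: c selfadjoint_mult)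
    then have sr: "selfadjoint r"
      by (rule nonneg_selfadjoint)
    then have "(norm r)\<^sup>2 = (norm c)\<^sup>2"
      using c rr by (simp flip: norm_selfadjoint_square)
    then have nr: "norm r = norm c"
      by simp
    define m where "m = r - c"
    have m: "selfadjoint m"
      using sr c by (simp add: m_def selfadjoint_diff)
    have rm: "r * m = m * r"
      by (simp add: m_def rc algebra_simps)
    have mm: "m * m = 2 *\<^sub>R (r * m)"
      by (simp add: m_def rr rc scaleR_2 algebra_simps)
    have "norm m \<le> 1"
      using norm_triangle_ineq4[of r c] nc nr by (simp add: m_def)
    then have bm: "mult_bound 1 (- (m * m)) 1"
      using m by (intro mult_bound_complement_square) auto
    define n where "n = small_root (m * m)"
    have nn: "n * n = m * m"
      unfolding n_def using bm by (rule small_root_square)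
    have nm: "n * m = m * n"
      unfolding n_def using bm bm by (rule small_root_intertwine) (rule mult.assoc)
    have nr': "n * r = r * n"
      unfolding n_def using bm bm by (rule small_root_intertwine) (metis rm mult.assoc)
    have n: "nonneg n"
      unfolding n_def using bm by (rule nonneg_small_root) (simp add: m selfadjoint_mult)
    define z where "z = n - m"
    have z: "selfadjoint z"
      using n m by (simp add: z_def selfadjoint_diff nonneg_selfadjoint)
    have rz: "r * z = z * r" and mz: "m * z = z * m" and nz: "n * z = z * n"
      by (simp_all add: z_def rm nm nr' algebra_simps)
    have nz': "n * z = - (z * m)"
      by (simp add: z_def nn nm algebra_simps)
    obtain p where p: "selfadjoint p" "p * p = r" "\<And>d. r * d = d * r \<Longrightarrow> p * d = d * p"
      using r by (blast dest: nonneg_root)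
    obtain q where q: "selfadjoint q" "q * q = n" "\<And>d. n * d = d * n \<Longrightarrow> q * d = d * q"
      using n by (blast dest: nonneg_root)
    have "q * r = r * q" and qz: "q * z = z * q"
      using q(3) nr' nz by blast+
    then have pq: "p * q = q * p" and pz: "p * z = z * p"
      using p(3) rz by metis+
    have spq: "selfadjoint (p * q * z)"
      using p(1) q(1) z pq pz qz by (intro selfadjoint_mult) (simp_all add: mult.assoc, metis mult.assoc)
    have "p * q * (p * q) = r * n"
      by (metis pq p(2) q(2) mult.assoc)
    moreover have "p * q * z = z * (p * q)"
      by (metis pz qz mult.assoc)
    ultimately have 1: "p * q * z * (p * q * z) = r * (n * z) * z"
      by (metis mult.assoc)
    have "z * m * (z * m) = z * (m * m) * z"
      by (metis mz mult.assoc)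
    also have "\<dots> = 2 *\<^sub>R (r * (z * m) * z)"
    proof -
      have "z * (r * m) = r * (z * m)"
        by (metis rz mult.assoc)
      then show ?thesis by (simp add: mm)
    qed
    also have "\<dots> = - (2 *\<^sub>R (p * q * z * (p * q * z)))"
      unfolding 1 nz' by simp
    finally have "z * m * (z * m) + (sqrt 2 *\<^sub>R (p * q * z)) * (sqrt 2 *\<^sub>R (p * q * z)) = 0"
      by simp
    moreover have "selfadjoint (z * m)"
      using z m mz by (simp add: selfadjoint_mult)
    ultimately have "z * m = 0"
      using spq by (blast intro: sum_squares_eq_0 selfadjoint_scaleR)
    with nz' have "z * z = 0"
      by (simp add: z_def algebra_simps nm nn)
    with z have "z = 0"
      by (rule selfadjoint_square_eq_0)
    with n have "nonneg m"
      by (simp add: z_def)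
    with r nr show ?thesis
      by (auto simp: m_def)
  qed
  show ?thesis
  proof (cases "c = 0")
    case False
    define l where "l = 2 * norm c"
    have l: "0 < l" using False by (simp add: l_def)
    have "norm ((1/l) *\<^sub>R c) \<le> 1/2"
      using False by (simp add: l_def)
    from small[OF selfadjoint_scaleR[OF c] this] obtain r
      where r: "nonneg r" "nonneg (r - (1/l) *\<^sub>R c)" "norm r = norm ((1/l) *\<^sub>R c)"
      by blast
    have "nonneg (l *\<^sub>R r)" "nonneg (l *\<^sub>R (r - (1/l) *\<^sub>R c))"
      using r l by (auto intro: nonneg_scaleR)
    moreover have "norm (l *\<^sub>R r) = norm c"
      using r(3) l by simp
    ultimately show ?thesis
      using l by (auto simp: scaleR_diff_right intro!: exI[of _ "l *\<^sub>R r"])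
  qed (auto intro: exI[of _ 0])
qed

lemma nonneg_sum: "(\<And>i. i \<in> I \<Longrightarrow> nonneg (f i)) \<Longrightarrow> nonneg (sum f I)"
  by (induction I rule: infinite_finite_induct) (auto intro: nonneg_add)

lemma nonneg_scaleR_ge0: "nonneg a \<Longrightarrow> 0 \<le> r \<Longrightarrow> nonneg (r *\<^sub>R a)"
  using nonneg_scaleR[of a r] by (cases "r = 0") auto

text \<open>The expression is (1 - e) y (1 - e), multiplied out to avoid a unit.\<close>

lemma nonneg_complement_conj:
  fixes e :: "'a::cstar_algebra"
  assumes "nonneg y" "selfadjoint e"
  shows "nonneg (y - e * y - y * e + e * y * e)"
proof -
  obtain k where k: "selfadjoint k" "k * k = y"
    using assms(1) by (blast dest: nonneg_root)
  have "y - e * y - y * e + e * y * e = star (k - k * e) * (k - k * e)"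
    using k(1) assms(2) by (simp add: selfadjoint_def algebra_simps flip: k(2))
  then show ?thesis
    by (simp only: nonneg_star_mult)
qed

section \<open>Approximate units\<close>

text \<open>\<open>1 - approx_unit H n = (1 - H)\<^bsup>2n\<^esup>\<close>.\<close>

primrec half_unit :: "'a::cstar_algebra \<Rightarrow> nat \<Rightarrow> 'a" where
  "half_unit H 0 = 0"
| "half_unit H (Suc n) = half_unit H n + H - H * half_unit H n"

definition approx_unit :: "'a::cstar_algebra \<Rightarrow> nat \<Rightarrow> 'a" where
  "approx_unit H n = 2 *\<^sub>R half_unit H n - half_unit H n * half_unit H n"

lemma half_unit_commute: "H * d = d * H \<Longrightarrow> half_unit H n * d = d * half_unit H n"
  by (induction n) (simp_all add: algebra_simps, metis mult.assoc)

lemma selfadjoint_half_unit: "selfadjoint H \<Longrightarrow> selfadjoint (half_unit H n)"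
proof (induction n)
  case (Suc n)
  have "half_unit H n * H = H * half_unit H n"
    by (rule half_unit_commute) simp
  with Suc show ?case
    by (simp add: selfadjoint_def)
qed simp

lemma mult_bound_half_unit:
  assumes "nonneg H" "norm H \<le> 1"
  shows "mult_bound 1 (- half_unit H n) 1"
proof (induction n)
  case 0
  then show ?case using mult_bound_scalar[of 1] by simp
next
  case (Suc n)
  have "mult_bound 1 (- H) 1"
    using assms by (intro nonneg_mult_bound) auto
  from mult_bound_mult[OF this Suc] show ?case
    by (simp add: algebra_simps)
qed

lemma norm_half_unit_le: "nonneg H \<Longrightarrow> norm H \<le> 1 \<Longrightarrow> norm (half_unit H n) \<le> 2"
  using mult_bound_imp_norm_le[OF mult_bound_half_unit] by fastforce

lemma selfadjoint_approx_unit: "selfadjoint H \<Longrightarrow> selfadjoint (approx_unit H n)"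
  unfolding approx_unit_def
  by (intro selfadjoint_diff selfadjoint_scaleR selfadjoint_mult selfadjoint_half_unit) auto

lemma mult_bound_approx_unit:
  assumes "nonneg H" "norm H \<le> 1"
  shows "mult_bound 1 (- approx_unit H n) 1"
  using mult_bound_mult[OF mult_bound_half_unit[OF assms] mult_bound_half_unit[OF assms], of n n]
  by (simp add: approx_unit_def scaleR_2 algebra_simps)

lemma norm_approx_unit_le: "nonneg H \<Longrightarrow> norm H \<le> 1 \<Longrightarrow> norm (approx_unit H n) \<le> 2"
  using mult_bound_imp_norm_le[OF mult_bound_approx_unit] by fastforce

lemma nonneg_approx_unit: "nonneg H \<Longrightarrow> norm H \<le> 1 \<Longrightarrow> nonneg (approx_unit H n)"
  unfolding nonneg_def[of "approx_unit H n"]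
  using mult_bound_approx_unit[of H n] selfadjoint_approx_unit[OF nonneg_selfadjoint] zero_less_one
  by blast

text \<open>\<open>r = (1 - H)\<^sup>n k\<close>, where \<open>k\<^sup>2 = H\<close>.\<close>

lemma approx_unit_step:
  fixes H :: "'a::cstar_algebra"
  assumes "selfadjoint k" "k * k = H" and r_def: "r = k - half_unit H n * k"
  shows "selfadjoint r" "H * r = r * H"
    and "r * r = H - half_unit H n * H - H * half_unit H n + half_unit H n * H * half_unit H n"
    and "k - half_unit H (Suc n) * k = r - H * r"
    and "approx_unit H (Suc n) - approx_unit H n = 2 *\<^sub>R (r * r) - r * H * r"
proof -
  let ?E = "half_unit H n"
  have kH: "H * k = k * H"
    by (simp add: mult.assoc flip: assms(2))
  have Ek: "?E * k = k * ?E" and EH: "?E * H = H * ?E"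
    using kH by (auto intro!: half_unit_commute)
  have "selfadjoint H"
    using assms(1,2) by (auto simp: selfadjoint_def)
  then have "selfadjoint ?E"
    by (rule selfadjoint_half_unit)
  then show "selfadjoint r"
    using assms(1) Ek by (auto simp: r_def intro!: selfadjoint_diff selfadjoint_mult)
  have "H * (?E * k) = ?E * k * H"
    by (metis kH EH mult.assoc)
  then show "H * r = r * H"
    by (simp add: r_def kH algebra_simps)
  have Ek': "?E * (k * x) = k * (?E * x)" and EH': "?E * (H * x) = H * (?E * x)"
    and kH': "H * (k * x) = k * (H * x)" and kk: "k * (k * x) = H * x" for x
    by (metis Ek EH kH assms(2) mult.assoc)+
  show rr: "r * r = H - ?E * H - H * ?E + ?E * H * ?E"
    by (simp add: r_def algebra_simps Ek Ek' EH EH' kk assms(2))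
  show "k - half_unit H (Suc n) * k = r - H * r"
    by (simp add: r_def algebra_simps)
  show "approx_unit H (Suc n) - approx_unit H n = 2 *\<^sub>R (r * r) - r * H * r"
    by (simp add: approx_unit_def r_def algebra_simps Ek Ek' EH EH' kk kH kH' assms(2) scaleR_2)
qed

lemma approx_unit_mono:
  assumes "nonneg H" "norm H \<le> 1"
  shows "nonneg (approx_unit H (Suc n) - approx_unit H n)"
proof -
  obtain k where k: "selfadjoint k" "k * k = H"
    using assms(1) by (blast dest: nonneg_root)
  define r where "r = k - half_unit H n * k"
  note r = approx_unit_step[OF k r_def]
  then have sr: "star r = r" by (simp add: selfadjoint_def)
  have "nonneg (r * r + (1 *\<^sub>R (star r * r) - star r * H * r))"
    using assms r(1) by (intro nonneg_add nonneg_norm_conj nonneg_square) (auto simp: nonneg_selfadjoint)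
  then show ?thesis
    by (simp add: r(5) sr scaleR_2 add_diff_eq)
qed

text \<open>The element inside the norm is q n = (1 - H)^n H (1 - H)^n. The q i decrease and each is
  at most the i-th increment of \<open>approx_unit H\<close>, so n q n \<le> q 0 + ... + q (n - 1)
  \<le> \<open>approx_unit H n\<close>, whose norm is at most 2.\<close>

lemma approx_unit_decay:
  fixes H :: "'a::cstar_algebra"
  assumes "nonneg H" "norm H \<le> 1"
  shows "real n * norm (H - half_unit H n * H - H * half_unit H n + half_unit H n * H * half_unit H n) \<le> 2"
proof -
  obtain k where k: "selfadjoint k" "k * k = H"
    using assms(1) by (blast dest: nonneg_root)
  have sH: "selfadjoint H"
    using assms(1) by (rule nonneg_selfadjoint)
  define r where "r n = k - half_unit H n * k" for n
  define q where "q n = r n * r n" for n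
  note r = approx_unit_step[OF k r_def]
  have sr: "star (r i) = r i" for i
    using r(1) by (simp add: selfadjoint_def)
  have q: "nonneg (q i)" for i
    unfolding q_def using r(1) by (rule nonneg_square)
  have step: "nonneg (q i - r i * H * r i)" for i
    using nonneg_norm_conj[OF sH assms(2), of "r i"] by (simp add: sr q_def)
  have upper: "nonneg (approx_unit H m - (\<Sum>i<m. q i))" for m
  proof (induction m)
    case 0
    then show ?case by (simp add: approx_unit_def)
  next
    case (Suc m)
    have eq: "approx_unit H (Suc m) - (\<Sum>i<Suc m. q i)
        = (approx_unit H m - (\<Sum>i<m. q i)) + (q m - r m * H * r m)"
      using r(5)[of m] by (simp add: q_def scaleR_2 algebra_simps)
    show ?case
      unfolding eq by (rule nonneg_add[OF Suc step])
  qed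
  have dec: "nonneg (q i - q (Suc i))" for i
  proof -
    have "nonneg (1 *\<^sub>R (star k * k) - star k * H * k)"
      using assms sH by (intro nonneg_norm_conj) auto
    then have "nonneg (H - H * H)"
      using k(1) by (simp add: selfadjoint_def mult.assoc flip: k(2))
    then have "nonneg (star (r i) * (H - H * H) * r i + star (r i) * H * r i)"
      by (intro nonneg_add nonneg_conj assms(1))
    also have "star (r i) * (H - H * H) * r i + star (r i) * H * r i = q i - q (Suc i)"
    proof -
      have rS: "r (Suc i) = r i - H * r i"
        using r(4)[of i] by (simp add: r_def)
      have "H * (r i * x) = r i * (H * x)" for x
        by (metis r(2) mult.assoc)
      then show ?thesis
        by (simp add: q_def sr rS r(2) algebra_simps)
    qed
    finally show ?thesis .
  qed
  have dec': "nonneg (q i - q (i + m))" for i m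
  proof (induction m)
    case (Suc m)
    from nonneg_add[OF Suc dec[of "i + m"]] show ?case by simp
  qed simp
  have "nonneg ((\<Sum>i<n. q i - q n) + (approx_unit H n - (\<Sum>i<n. q i)))"
  proof (intro nonneg_add nonneg_sum upper)
    fix i assume "i \<in> {..<n}"
    then show "nonneg (q i - q n)"
      using dec'[of i "n - i"] by simp
  qed
  then have "nonneg (approx_unit H n - real n *\<^sub>R q n)"
    by (simp add: sum_subtractf sum_constant_scaleR)
  then have "norm (real n *\<^sub>R q n) \<le> norm (approx_unit H n)"
    using q by (intro nonneg_norm_mono nonneg_scaleR_ge0) auto
  also have "\<dots> \<le> 2"
    using assms by (rule norm_approx_unit_le)
  finally show ?thesis
    by (simp add: q_def r(3))
qed

text \<open>Compressing \<open>star c * c\<close> \<le> C H by 1 - E with E =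
  \<open>half_unit H n\<close> bounds the squared norm of c (1 - E) by a multiple of 1/n. As 1 -
  \<open>approx_unit H n\<close> = (1 - E)^2, one further factor 1 - E remains, which costs at most
  1 + 2 = 3.\<close>

lemma approx_unit_tendsto:
  fixes c :: "'a::cstar_algebra"
  assumes "nonneg H" "norm H \<le> 1" and dom: "nonneg (C *\<^sub>R H - star c * c)"
  shows "(\<lambda>n. c - c * approx_unit H n) \<longlonglongrightarrow> 0"
proof -
  define C' where "C' = max C 0"
  have "nonneg ((C *\<^sub>R H - star c * c) + (C' - C) *\<^sub>R H)"
    using assms by (intro nonneg_add nonneg_scaleR_ge0) (auto simp: C'_def)
  then have dom': "nonneg (C' *\<^sub>R H - star c * c)"
    by (simp add: algebra_simps)
  have C': "0 \<le> C'" by (simp add: C'_def)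
  let ?E = "half_unit H"
  have sE: "star (?E n) = ?E n" for n
    using selfadjoint_half_unit[OF nonneg_selfadjoint[OF assms(1)]] by (simp add: selfadjoint_def)
  have b: "(norm (c - c * ?E n))\<^sup>2 \<le> C' * 2 / real n" if "0 < n" for n
  proof -
    let ?h = "H - ?E n * H - H * ?E n + ?E n * H * ?E n"
    have "nonneg ((C' *\<^sub>R H - star c * c) - ?E n * (C' *\<^sub>R H - star c * c)
        - (C' *\<^sub>R H - star c * c) * ?E n + ?E n * (C' *\<^sub>R H - star c * c) * ?E n)"
      using dom' by (intro nonneg_complement_conj) (simp_all add: selfadjoint_def sE)
    then have "nonneg (C' *\<^sub>R ?h - star (c - c * ?E n) * (c - c * ?E n))"
      by (simp add: sE algebra_simps)
    then have "norm (star (c - c * ?E n) * (c - c * ?E n)) \<le> norm (C' *\<^sub>R ?h)"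
      by (intro nonneg_norm_mono nonneg_star_mult)
    also have "\<dots> = C' * norm ?h"
      using C' by simp
    also have "\<dots> \<le> C' * (2 / real n)"
      using approx_unit_decay[OF assms(1,2), of n] C' that
      by (intro mult_left_mono) (simp_all add: field_simps)
    finally show ?thesis
      by (simp only: cstar_identity times_divide_eq_right)
  qed
  have "(\<lambda>n. (norm (c - c * ?E n))\<^sup>2) \<longlonglongrightarrow> 0"
  proof (rule tendsto_sandwich[OF _ _ tendsto_const])
    show "(\<lambda>n. C' * 2 / real n) \<longlonglongrightarrow> 0"
      by (rule lim_const_over_n)
    show "\<forall>\<^sub>F n in sequentially. (norm (c - c * ?E n))\<^sup>2 \<le> C' * 2 / real n"
      using eventually_gt_at_top[of 0] by eventually_elim (rule b)
  qed simp
  from tendsto_real_sqrt[OF this] have "(\<lambda>n. norm (c - c * ?E n)) \<longlonglongrightarrow> 0"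
    by simp
  then have "(\<lambda>n. 3 * norm (c - c * ?E n)) \<longlonglongrightarrow> 0"
    using tendsto_mult_right_zero by blast
  then show ?thesis
  proof (rule Lim_null_comparison[rotated])
    have "norm (c - c * approx_unit H n) \<le> 3 * norm (c - c * ?E n)" for n
    proof -
      have "c - c * approx_unit H n = (c - c * ?E n) - (c - c * ?E n) * ?E n"
        by (simp add: approx_unit_def scaleR_2 algebra_simps)
      then have "norm (c - c * approx_unit H n) \<le> norm (c - c * ?E n) + norm ((c - c * ?E n) * ?E n)"
        by (metis norm_triangle_ineq4)
      also have "norm ((c - c * ?E n) * ?E n) \<le> norm (c - c * ?E n) * 2"
        using norm_half_unit_le[OF assms(1,2), of n]
        by (intro order_trans[OF norm_mult_ineq] mult_left_mono) auto
      finally show ?thesis by simp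
    qed
    then show "\<forall>\<^sub>F n in sequentially. norm (c - c * approx_unit H n) \<le> 3 * norm (c - c * ?E n)"
      by simp
  qed
qed

section \<open>Closed ideals and quasi-central averaging\<close>

text \<open>Closed two-sided ideals of C*-algebras are closed under \<open>star\<close>; this is
  kept as an assumption because the quotient map supplies it at once.\<close>

locale star_ideal =
  fixes J :: "'a::cstar_algebra set"
  assumes closed_ideal: "closed_ideal J"
    and star: "x \<in> J \<Longrightarrow> star x \<in> J"
begin

lemma zero: "0 \<in> J"
  and add: "x \<in> J \<Longrightarrow> y \<in> J \<Longrightarrow> x + y \<in> J"
  and mult_left: "x \<in> J \<Longrightarrow> a * x \<in> J"
  and mult_right: "x \<in> J \<Longrightarrow> x * a \<in> J"
  using closed_ideal by (auto simp: closed_ideal_def)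

lemma scaleR: "x \<in> J \<Longrightarrow> r *\<^sub>R x \<in> J"
  using closed_ideal by (simp add: closed_ideal_def scaleR_scaleC)

lemma minus: "x \<in> J \<Longrightarrow> - x \<in> J"
  using scaleR[of x "-1"] by simp

lemma diff: "x \<in> J \<Longrightarrow> y \<in> J \<Longrightarrow> x - y \<in> J"
  using add[of x "- y"] minus by simp

lemma sum: "(\<And>i. i \<in> I \<Longrightarrow> f i \<in> J) \<Longrightarrow> Groups_Big.sum f I \<in> J"
  by (induction I rule: infinite_finite_induct) (auto intro: zero add)

lemma approx_unit: "H \<in> J \<Longrightarrow> approx_unit H n \<in> J"
proof -
  assume "H \<in> J"
  then have "half_unit H n \<in> J"
    by (induction n) (auto intro: zero add diff mult_right)
  then show ?thesis
    by (auto simp: approx_unit_def intro: diff scaleR mult_left)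
qed

text \<open>One positive H in J, a normalized sum of all \<open>star x * x\<close>, dominates every
  \<open>star x * x\<close> up to a constant, so its approximate units serve all x simultaneously.
  Including the adjoints gives the estimate on the other side.\<close>

lemma finite_approx_unit:
  assumes "finite F" "F \<subseteq> J" "0 < \<epsilon>"
  shows "\<exists>e\<in>J. selfadjoint e \<and> nonneg e \<and> norm e \<le> 2 \<and>
    (\<forall>x\<in>F. norm (x - x * e) < \<epsilon> \<and> norm (x - e * x) < \<epsilon>)"
proof -
  define F' where "F' = F \<union> star ` F"
  have F': "finite F'" "F' \<subseteq> J"
    using assms star by (auto simp: F'_def)
  define h where "h = (\<Sum>x\<in>F'. star x * x)"
  define s where "s = norm h + 1"
  have s: "0 < s" by (simp add: s_def add_nonneg_pos)
  define H where "H = (1/s) *\<^sub>R h"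
  have h: "nonneg h" "h \<in> J"
    using F' by (auto simp: h_def intro!: nonneg_sum nonneg_star_mult sum mult_left)
  have H: "nonneg H" "norm H \<le> 1" "H \<in> J"
    using h s by (auto simp: H_def intro: nonneg_scaleR scaleR) (simp add: s_def)
  have lim: "(\<lambda>n. x - x * approx_unit H n) \<longlonglongrightarrow> 0" if "x \<in> F'" for x
  proof (rule approx_unit_tendsto[OF H(1,2)])
    have "h - star x * x = (\<Sum>y\<in>F' - {x}. star y * y)"
      using F'(1) that by (simp add: h_def sum_diff1)
    then have "nonneg (h - star x * x)"
      by (simp add: nonneg_sum nonneg_star_mult)
    then show "nonneg (s *\<^sub>R H - star x * x)"
      using s by (simp add: H_def)
  qed
  have "\<forall>\<^sub>F n in sequentially. \<forall>x\<in>F'. dist (x - x * approx_unit H n) 0 < \<epsilon>"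
    using F'(1) assms(3) lim by (intro eventually_ball_finite ballI tendstoD)
  then obtain n where n: "norm (x - x * approx_unit H n) < \<epsilon>" if "x \<in> F'" for x
    by (auto simp: eventually_sequentially)
  let ?e = "approx_unit H n"
  have e: "nonneg ?e" "norm ?e \<le> 2" "?e \<in> J"
    using H by (auto intro: nonneg_approx_unit norm_approx_unit_le approx_unit)
  then have "selfadjoint ?e" and "star ?e = ?e"
    by (auto dest: nonneg_selfadjoint simp: selfadjoint_def)
  moreover have "norm (x - ?e * x) < \<epsilon>" if "x \<in> F" for x
  proof -
    have "star (star x - star x * ?e) = x - ?e * x"
      using \<open>star ?e = ?e\<close> by simp
    then have "norm (x - ?e * x) = norm (star x - star x * ?e)"
      by (metis norm_star)
    with n[of "star x"] that show ?thesis
      by (simp add: F'_def)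
  qed
  ultimately show ?thesis
    using e n by (auto simp: F'_def)
qed

text \<open>Compressing \<open>p \<le> q + j\<close> by \<open>1 - e\<close> makes \<open>j\<close> small, but \<open>(1 - e) q (1 - e)\<close> exceeds \<open>q\<close> by
  up to \<open>- X - X\<^sup>*\<close> with \<open>X = e q (1 - e)\<close>. When \<open>e\<close> is almost a unit for the sum \<open>S\<close> of the
  earlier \<open>X\<close>s, the new \<open>X\<close> satisfies \<open>S X\<^sup>* \<approx> 0\<close>, so \<open>\<parallel>S\<parallel>\<close> grows only like the square root of the
  number of steps. This replaces a quasi-central approximate unit.\<close>

lemma averaging_sum:
  assumes p: "nonneg p" and fin: "finite L" and q: "\<And>l. l \<in> L \<Longrightarrow> nonneg (q l)"
    and M: "\<And>l. l \<in> L \<Longrightarrow> norm (q l) \<le> M" "0 \<le> M" and j: "\<And>l. l \<in> L \<Longrightarrow> j l \<in> J"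
    and le: "\<And>l. l \<in> L \<Longrightarrow> nonneg (q l + j l - p)" and "0 < \<eta>"
  shows "\<exists>P S G. nonneg P \<and> P - real N *\<^sub>R p \<in> J \<and>
    (\<forall>l\<in>L. S l \<in> J \<and> (norm (S l))\<^sup>2 \<le> real N * (36 * M\<^sup>2 + 1) \<and> norm (G l) \<le> real N * \<eta> \<and>
      nonneg (real N *\<^sub>R q l - (S l + star (S l)) + G l - P))"
proof (induction N)
  case 0
  show ?case
    by (intro exI[of _ 0] exI[of _ "\<lambda>_. 0"]) (simp add: zero)
next
  case (Suc N)
  then obtain P S G where P: "nonneg P" "P - real N *\<^sub>R p \<in> J"
    and S: "\<And>l. l \<in> L \<Longrightarrow> S l \<in> J" "\<And>l. l \<in> L \<Longrightarrow> (norm (S l))\<^sup>2 \<le> real N * (36 * M\<^sup>2 + 1)"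
    and G: "\<And>l. l \<in> L \<Longrightarrow> norm (G l) \<le> real N * \<eta>"
    and leP: "\<And>l. l \<in> L \<Longrightarrow> nonneg (real N *\<^sub>R q l - (S l + star (S l)) + G l - P)"
    by blast
  \<comment> \<open>Compressing \<open>j l\<close> costs 3 \<epsilon>, since \<open>e\<close> has
    norm at most 2, and this must not exceed \<eta>. The two cross terms cost 4 M \<epsilon>, to be
    at most 1. The other summand 36 M^2 is the square of the bound 2 M + 4 M for
    \<open>X l\<close>.\<close>
  define \<epsilon> where "\<epsilon> = min (\<eta> / 3) (1 / (4 * M + 1))"
  have \<epsilon>: "0 < \<epsilon>" "3 * \<epsilon> \<le> \<eta>" "\<epsilon> * (4 * M) \<le> 1"
  proof -
    show "0 < \<epsilon>" "3 * \<epsilon> \<le> \<eta>" using \<open>0 < \<eta>\<close> M(2) by (auto simp: \<epsilon>_def)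
    have "\<epsilon> * (4 * M) \<le> 1 / (4 * M + 1) * (4 * M)"
      using M(2) by (intro mult_right_mono) (auto simp: \<epsilon>_def)
    also have "\<dots> \<le> 1" using M(2) by (simp add: field_simps)
    finally show "\<epsilon> * (4 * M) \<le> 1" .
  qed
  have "finite (S ` L \<union> j ` L)" "S ` L \<union> j ` L \<subseteq> J"
    using fin S(1) j by auto
  from finite_approx_unit[OF this \<epsilon>(1)] obtain e
    where e: "e \<in> J" "selfadjoint e" "nonneg e" "norm e \<le> 2"
      and eS: "\<And>l. l \<in> L \<Longrightarrow> norm (S l - S l * e) < \<epsilon>"
      and ej: "\<And>l. l \<in> L \<Longrightarrow> norm (j l - e * j l) < \<epsilon>"
    by blast
  have se: "star e = e" using e(2) by (simp add: selfadjoint_def)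
  have sq: "star (q l) = q l" if "l \<in> L" for l
    using nonneg_selfadjoint[OF q[OF that]] by (simp add: selfadjoint_def)
  define X where "X l = e * q l - e * q l * e" for l
  define c where "c y = y - e * y - y * e + e * y * e" for y
  have c: "nonneg (c y)" if "nonneg y" for y
    unfolding c_def using that e(2) by (rule nonneg_complement_conj)
  have P': "nonneg (P + c p)"
    using P(1) p by (intro nonneg_add c)
  have PJ': "P + c p - real (Suc N) *\<^sub>R p \<in> J"
  proof -
    have "P + c p - real (Suc N) *\<^sub>R p = (P - real N *\<^sub>R p) + ((e * p) * e - e * p - p * e)"
      by (simp add: c_def algebra_simps)
    also have "\<dots> \<in> J"
      using e(1) P(2) by (blast intro: add diff mult_right mult_left)
    finally show ?thesis .
  qed
  have SG': "S l + X l \<in> J \<and> (norm (S l + X l))\<^sup>2 \<le> real (Suc N) * (36 * M\<^sup>2 + 1) \<and>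
      norm (G l + c (j l)) \<le> real (Suc N) * \<eta> \<and>
      nonneg (real (Suc N) *\<^sub>R q l - (S l + X l + star (S l + X l)) + (G l + c (j l)) - (P + c p))"
    if l: "l \<in> L" for l
  proof (intro conjI)
    show "S l + X l \<in> J"
      unfolding X_def using S(1)[OF l] e(1) by (intro add diff mult_right)
    have qe: "norm (q l * e) \<le> M * 2"
      using M(1)[OF l] M(2) e(4) by (intro order_trans[OF norm_mult_ineq] mult_mono) auto
    have eq: "norm (e * q l) \<le> 2 * M"
      using M(1)[OF l] M(2) e(4) by (intro order_trans[OF norm_mult_ineq] mult_mono) auto
    have "norm (X l) \<le> norm (e * q l) + norm (e * q l * e)"
      unfolding X_def by (rule norm_triangle_ineq4)
    also have "norm (e * q l * e) \<le> (2 * M) * 2"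
      by (rule order_trans[OF norm_mult_ineq mult_mono[OF eq e(4)]]) (use M(2) in auto)
    finally have nX: "norm (X l) \<le> 6 * M"
      using eq by simp
    have sX: "star (X l) = q l * e - e * q l * e"
      by (simp add: X_def se sq[OF l] mult.assoc)
    have "S l * star (X l) = (S l - S l * e) * (q l * e)"
      by (simp add: sX algebra_simps)
    then have "norm (S l * star (X l)) \<le> norm (S l - S l * e) * norm (q l * e)"
      by (simp only: norm_mult_ineq)
    also have "\<dots> \<le> \<epsilon> * (2 * M)"
      using eS[OF l] qe \<epsilon>(1) by (intro mult_mono) auto
    finally have cross: "2 * norm (S l * star (X l)) \<le> 1"
      using \<epsilon>(3) by simp
    have cross': "norm (X l * star (S l)) = norm (S l * star (X l))"
      using norm_star[of "S l * star (X l)"] by simp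
    have "(norm (S l + X l))\<^sup>2 = norm ((S l * star (S l) + X l * star (X l)) +
        (S l * star (X l) + X l * star (S l)))"
      using norm_mult_star[of "S l + X l"] by (simp add: algebra_simps)
    also have "\<dots> \<le> norm (S l * star (S l)) + norm (X l * star (X l)) +
        (norm (S l * star (X l)) + norm (X l * star (S l)))"
      by (intro norm_triangle_mono norm_triangle_ineq)
    also have "\<dots> = (norm (S l))\<^sup>2 + (norm (X l))\<^sup>2 + 2 * norm (S l * star (X l))"
      by (simp only: norm_mult_star cross' mult_2)
    also have "\<dots> \<le> real N * (36 * M\<^sup>2 + 1) + (6 * M)\<^sup>2 + 1"
      using S(2)[OF l] power_mono[OF nX, of 2] cross by (intro add_mono) auto
    finally show "(norm (S l + X l))\<^sup>2 \<le> real (Suc N) * (36 * M\<^sup>2 + 1)"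
      by (simp add: power2_eq_square algebra_simps)
    have "c (j l) = (j l - e * j l) - (j l - e * j l) * e"
      by (simp add: c_def algebra_simps)
    then have "norm (c (j l)) \<le> norm (j l - e * j l) + norm ((j l - e * j l) * e)"
      by (metis norm_triangle_ineq4)
    also have "norm ((j l - e * j l) * e) \<le> norm (j l - e * j l) * 2"
      using e(4) by (intro order_trans[OF norm_mult_ineq] mult_left_mono) auto
    finally have "norm (c (j l)) \<le> \<eta>"
      using ej[OF l] \<epsilon>(2) by simp
    with G[OF l] have "norm (G l + c (j l)) \<le> real N * \<eta> + \<eta>"
      by (rule norm_triangle_mono)
    then show "norm (G l + c (j l)) \<le> real (Suc N) * \<eta>"
      by (simp add: algebra_simps)
    \<comment> \<open>(1 - e) q (1 - e) + e q e is exactly q - X - \<open>star X\<close>, so adding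
      the positive term e q e puts the cost of the compression entirely into S.\<close>
    have "nonneg ((real N *\<^sub>R q l - (S l + star (S l)) + G l - P) + c (q l + j l - p)
        + star e * q l * e)"
      using le[OF l] q[OF l] leP[OF l] by (intro nonneg_add c nonneg_conj)
    also have "(real N *\<^sub>R q l - (S l + star (S l)) + G l - P) + c (q l + j l - p) + star e * q l * e
      = real (Suc N) *\<^sub>R q l - (S l + X l + star (S l + X l)) + (G l + c (j l)) - (P + c p)"
      by (simp add: sX) (simp add: X_def c_def se algebra_simps)
    finally show "nonneg (real (Suc N) *\<^sub>R q l - (S l + X l + star (S l + X l)) + (G l + c (j l)) - (P + c p))" .
  qed
  show ?case
    by (rule exI[of _ "P + c p"], rule exI[of _ "\<lambda>l. S l + X l"], rule exI[of _ "\<lambda>l. G l + c (j l)"],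
        rule conjI[OF P' conjI[OF PJ' ballI]], rule SG')
qed

text \<open>After division by N the cross terms have size sqrt (K/N). Choosing N above 16
  K/\<epsilon>^2 leaves \<epsilon>/4 for each of S and \<open>star S\<close>, beside \<epsilon>/2
  for G. The selfadjoint error is then replaced by a positive one of the same norm.\<close>

lemma averaging:
  assumes p: "nonneg p" and fin: "finite L" and q: "\<And>l. l \<in> L \<Longrightarrow> nonneg (q l)"
    and j: "\<And>l. l \<in> L \<Longrightarrow> j l \<in> J"
    and le: "\<And>l. l \<in> L \<Longrightarrow> nonneg (q l + j l - p)" and "0 < \<epsilon>"
  shows "\<exists>p' r. nonneg p' \<and> p' - p \<in> J \<and>
    (\<forall>l\<in>L. nonneg (r l) \<and> norm (r l) \<le> \<epsilon> \<and> nonneg (q l + r l - p'))"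
proof -
  define M where "M = (\<Sum>l\<in>L. norm (q l))"
  have M: "norm (q l) \<le> M" if "l \<in> L" for l
    unfolding M_def using fin that by (intro member_le_sum) auto
  have M0: "0 \<le> M" by (simp add: M_def sum_nonneg)
  define K where "K = 36 * M\<^sup>2 + 1"
  have K: "0 < K" by (simp add: K_def add_nonneg_pos)
  obtain N :: nat where N: "16 * K / \<epsilon>\<^sup>2 < real N"
    using reals_Archimedean2 by blast
  then have N0: "0 < real N"
    using K \<open>0 < \<epsilon>\<close> by (meson divide_pos_pos less_trans mult_pos_pos zero_less_numeral zero_less_power)
  have NK: "K / real N \<le> (\<epsilon> / 4)\<^sup>2"
    using N N0 \<open>0 < \<epsilon>\<close> by (simp add: field_simps power2_eq_square)
  have "\<exists>P S G. nonneg P \<and> P - real N *\<^sub>R p \<in> J \<and>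
    (\<forall>l\<in>L. S l \<in> J \<and> (norm (S l))\<^sup>2 \<le> real N * K \<and> norm (G l) \<le> real N * (\<epsilon> / 2) \<and>
      nonneg (real N *\<^sub>R q l - (S l + star (S l)) + G l - P))"
    unfolding K_def by (rule averaging_sum[OF p fin q M M0 j le]) (use \<open>0 < \<epsilon>\<close> in simp_all)
  then obtain P S G where P: "nonneg P" "P - real N *\<^sub>R p \<in> J"
    and S: "\<And>l. l \<in> L \<Longrightarrow> (norm (S l))\<^sup>2 \<le> real N * K"
    and G: "\<And>l. l \<in> L \<Longrightarrow> norm (G l) \<le> real N * (\<epsilon> / 2)"
    and leP: "\<And>l. l \<in> L \<Longrightarrow> nonneg (real N *\<^sub>R q l - (S l + star (S l)) + G l - P)"
    by blast
  define t where "t l = (1 / real N) *\<^sub>R (G l - (S l + star (S l)))" for l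
  define p' where "p' = (1 / real N) *\<^sub>R P"
  have p': "nonneg p'"
    using P(1) N0 by (simp add: p'_def nonneg_scaleR)
  have "p' - p = (1 / real N) *\<^sub>R (P - real N *\<^sub>R p)"
    using N0 by (simp add: p'_def scaleR_diff_right)
  then have pJ: "p' - p \<in> J"
    using P(2) by (simp add: scaleR)
  have t: "\<exists>r. nonneg r \<and> norm r \<le> \<epsilon> \<and> nonneg (q l + r - p')" if l: "l \<in> L" for l
  proof -
    have "nonneg ((1 / real N) *\<^sub>R (real N *\<^sub>R q l - (S l + star (S l)) + G l - P))"
      using leP[OF l] N0 by (simp add: nonneg_scaleR)
    also have "(1 / real N) *\<^sub>R (real N *\<^sub>R q l - (S l + star (S l)) + G l - P) = q l + t l - p'"
      using N0 by (simp add: t_def p'_def algebra_simps)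
    finally have 1: "nonneg (q l + t l - p')" .
    \<comment> \<open>Selfadjointness of \<open>G l\<close> was not carried through the induction;
      it is read off from the positivity just obtained.\<close>
    have "selfadjoint ((q l + t l - p') + p' - q l)"
      using 1 p' q[OF l] by (intro selfadjoint_add selfadjoint_diff[OF _ nonneg_selfadjoint] nonneg_selfadjoint)
    then have "selfadjoint (t l)" by simp
    then obtain r where r: "nonneg r" "nonneg (r - t l)" "norm r = norm (t l)"
      using absolute_value_ex by blast
    have "(norm (S l) / real N)\<^sup>2 \<le> K / real N"
      using S[OF l] N0 by (simp add: power_divide divide_simps power2_eq_square mult.commute)
    also note NK
    finally have S4: "norm (S l) / real N \<le> \<epsilon> / 4"
      by (rule power2_le_imp_le) (use \<open>0 < \<epsilon>\<close> in simp)
    have "norm (t l) = norm (G l - (S l + star (S l))) / real N"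
      using N0 by (simp add: t_def)
    also have "\<dots> \<le> (norm (G l) + (norm (S l) + norm (S l))) / real N"
      using norm_triangle_ineq4[of "G l" "S l + star (S l)"] norm_triangle_ineq[of "S l" "star (S l)"] N0
      by (intro divide_right_mono) auto
    also have "\<dots> = norm (G l) / real N + 2 * (norm (S l) / real N)"
      by (simp add: add_divide_distrib)
    also have "\<dots> \<le> \<epsilon> / 2 + 2 * (\<epsilon> / 4)"
      using G[OF l] S4 N0 by (intro add_mono) (auto simp: field_simps)
    finally have "norm r \<le> \<epsilon>"
      using r(3) by simp
    moreover have "nonneg (q l + r - p')"
      using nonneg_add[OF 1 r(2)] by (simp add: algebra_simps)
    ultimately show ?thesis
      using r(1) by blast
  qed
  then obtain r where "\<And>l. l \<in> L \<Longrightarrow> nonneg (r l) \<and> norm (r l) \<le> \<epsilon> \<and> nonneg (q l + r l - p')"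
    by metis
  with p' pJ show ?thesis by blast
qed

end

lemma geometric_increments_limit:
  fixes c :: "nat \<Rightarrow> 'a::banach"
  assumes "\<And>n. norm (c (Suc n) - c n) \<le> K * (1/2)^n"
  shows "\<exists>L. c \<longlonglongrightarrow> L \<and> norm (L - c 0) \<le> 2 * K"
proof -
  have s: "summable (\<lambda>n. K * (1/2)^n)"
    by (intro summable_mult summable_geometric) simp
  then have d: "summable (\<lambda>n. norm (c (Suc n) - c n))"
    by (rule summable_comparison_test'[of _ 0]) (use assms in simp)
  then have "(\<lambda>n. \<Sum>i<n. c (Suc i) - c i) \<longlonglongrightarrow> (\<Sum>i. c (Suc i) - c i)"
    by (rule summable_LIMSEQ[OF summable_norm_cancel])
  then have "(\<lambda>n. (c n - c 0) + c 0) \<longlonglongrightarrow> (\<Sum>i. c (Suc i) - c i) + c 0"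
    by (intro tendsto_add tendsto_const) (simp add: sum_lessThan_telescope)
  then have "c \<longlonglongrightarrow> (\<Sum>i. c (Suc i) - c i) + c 0"
    by simp
  moreover have "norm (\<Sum>i. c (Suc i) - c i) \<le> (\<Sum>i. K * (1/2)^i)"
    by (rule order_trans[OF summable_norm[OF d] suminf_le[OF assms d s]])
  moreover have "(\<Sum>i. K * (1/2)^i) = 2 * K"
    by (subst suminf_mult) (simp_all add: suminf_geometric summable_geometric)
  ultimately show ?thesis
    by (intro exI[of _ "(\<Sum>i. c (Suc i) - c i) + c 0"]) simp
qed

section \<open>Lifting along the quotient map\<close>

locale cstar_quotient =
  fixes J :: "'a::cstar_algebra set" and \<pi> :: "'a \<Rightarrow> 'q::cstar_algebra"
  assumes ideal: "closed_ideal J"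
    and hom_add: "\<pi> (a + b) = \<pi> a + \<pi> b"
    and hom_mult: "\<pi> (a * b) = \<pi> a * \<pi> b"
    and hom_scaleC: "\<pi> (c *\<^sub>C a) = c *\<^sub>C \<pi> a"
    and hom_star: "\<pi> (star a) = star (\<pi> a)"
    and norm_le: "norm (\<pi> a) \<le> norm a"
    and surj: "surj \<pi>"
    and ker: "\<pi> a = 0 \<longleftrightarrow> a \<in> J"
begin

sublocale star_ideal J
proof
  show "closed_ideal J" by (rule ideal)
  show "star x \<in> J" if "x \<in> J" for x
    using that by (simp add: hom_star flip: ker)
qed

lemma hom_scaleR: "\<pi> (r *\<^sub>R a) = r *\<^sub>R \<pi> a"
  by (simp add: scaleR_scaleC hom_scaleC)

lemma bounded_linear_hom: "bounded_linear \<pi>"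
  by (rule bounded_linear_intro[of _ 1]) (simp_all add: hom_add hom_scaleR norm_le)

lemmas hom_diff = linear_diff[OF bounded_linear.linear[OF bounded_linear_hom]]

lemma hom_nonneg: "nonneg a \<Longrightarrow> nonneg (\<pi> a)"
  unfolding cstar_pos_iff_nonneg[symmetric] cstar_pos_def by (metis hom_mult hom_star)

lemma lift_nonneg: "nonneg x \<Longrightarrow> \<exists>a. nonneg a \<and> \<pi> a = x"
  unfolding cstar_pos_iff_nonneg[symmetric] cstar_pos_def by (metis hom_mult hom_star surj surjD)

lemma lift_selfadjoint:
  assumes "selfadjoint x"
  shows "\<exists>a. selfadjoint a \<and> \<pi> a = x"
proof -
  obtain c where c: "x = \<pi> c"
    using surj by (metis surjD)
  have "\<pi> ((1/2) *\<^sub>R (c + star c)) = (1/2) *\<^sub>R (x + x)"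
    using assms by (simp add: hom_scaleR hom_add hom_star c selfadjoint_def)
  also have "\<dots> = x"
    by (simp flip: scaleR_2)
  finally show ?thesis
    by (intro exI[of _ "(1/2) *\<^sub>R (c + star c)"]) (simp add: selfadjoint_def add.commute)
qed

text \<open>One step of the recursion: the old upper bounds \<open>b l\<close>, and a fresh one lifting \<open>y n\<close>, are raised
  by a small positive amount so that they dominate a lift of the next \<open>x\<close>.\<close>

lemma interpolation_step:
  fixes n :: nat
  assumes x: "nonneg (x' - x)" and y: "\<And>l. l \<le> n \<Longrightarrow> nonneg (y l - x')" and "0 < \<epsilon>"
    and a: "selfadjoint a" "\<pi> a = x"
    and b: "\<And>l. l < n \<Longrightarrow> nonneg (b l - a)" "\<And>l. l < n \<Longrightarrow> nonneg (\<pi> (b l) - y l)"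
  shows "\<exists>a' b'. selfadjoint a' \<and> \<pi> a' = x' \<and> nonneg (a' - a) \<and>
    (\<forall>l\<le>n. nonneg (b' l - a') \<and> nonneg (\<pi> (b' l) - y l)) \<and>
    (\<forall>l<n. norm (b' l - b l) \<le> \<epsilon>) \<and> norm (\<pi> (b' n) - y n) \<le> \<epsilon>"
proof -
  have "nonneg (y n - x)"
    using nonneg_add[OF x y[OF order_refl]] by simp
  then obtain B where B: "nonneg B" "\<pi> B = y n - x"
    using lift_nonneg by blast
  \<comment> \<open>The fresh bound starts as an exact lift of \<open>y n\<close> lying above
    \<open>a\<close>.\<close>
  define b0 where "b0 = b(n := a + B)"
  have b0: "nonneg (b0 l - a)" "nonneg (\<pi> (b0 l) - y l)" if "l \<le> n" for l
    using b[of l] B that by (auto simp: b0_def hom_add a(2))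
  have b0n: "\<pi> (b0 n) = y n"
    by (simp add: b0_def hom_add a(2) B(2))
  obtain p where p: "nonneg p" "\<pi> p = x' - x"
    using lift_nonneg x by blast
  have "\<exists>w. nonneg w \<and> \<pi> w = \<pi> (b0 l - a) - \<pi> p" if "l \<le> n" for l
  proof -
    have "nonneg ((\<pi> (b0 l) - y l) + (y l - x'))"
      using b0(2) y that by (intro nonneg_add) auto
    then have "nonneg (\<pi> (b0 l - a) - \<pi> p)"
      by (simp add: hom_diff a(2) p(2))
    then show ?thesis by (rule lift_nonneg)
  qed
  then obtain w where w: "\<And>l. l \<le> n \<Longrightarrow> nonneg (w l)"
      "\<And>l. l \<le> n \<Longrightarrow> \<pi> (w l) = \<pi> (b0 l - a) - \<pi> p"
    by metis
  have "\<exists>p' r. nonneg p' \<and> p' - p \<in> J \<and>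
    (\<forall>l\<in>{..n}. nonneg (r l) \<and> norm (r l) \<le> \<epsilon> \<and> nonneg ((b0 l - a) + r l - p'))"
  \<comment> \<open>The inequality p \<le> \<open>b0 l - a\<close> holds only in the quotient. The
    positive lift \<open>w l\<close> of the difference yields the element of J that corrects
    it.\<close>
  proof (rule averaging[of p _ _ "\<lambda>l. w l + p - (b0 l - a)"])
    fix l assume l: "l \<in> {..n}"
    show "nonneg (b0 l - a)" using b0(1) l by simp
    have "\<pi> (w l + p - (b0 l - a)) = 0"
      using w(2) l by (simp add: hom_add hom_diff)
    then show "w l + p - (b0 l - a) \<in> J"
      by (simp only: ker)
    show "nonneg (b0 l - a + (w l + p - (b0 l - a)) - p)"
      using w(1) l by simp
  qed (use p \<open>0 < \<epsilon>\<close> in auto)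
  then obtain p' r where p': "nonneg p'" "p' - p \<in> J"
    and r: "\<And>l. l \<le> n \<Longrightarrow> nonneg (r l)" "\<And>l. l \<le> n \<Longrightarrow> norm (r l) \<le> \<epsilon>"
      "\<And>l. l \<le> n \<Longrightarrow> nonneg ((b0 l - a) + r l - p')"
    by (metis atMost_iff)
  define a' b' where "a' = a + p'" and "b' l = b0 l + r l" for l
  have "\<pi> p' = \<pi> p"
    using p'(2) by (simp add: hom_diff flip: ker)
  then have "\<pi> a' = x'"
    by (simp add: a'_def hom_add a(2) p(2))
  moreover have "nonneg (b' l - a') \<and> nonneg (\<pi> (b' l) - y l)" if "l \<le> n" for l
  proof
    show "nonneg (b' l - a')"
      using r(3)[OF that] by (simp add: b'_def a'_def algebra_simps)
    show "nonneg (\<pi> (b' l) - y l)"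
      using nonneg_add[OF b0(2)[OF that] hom_nonneg[OF r(1)[OF that]]]
      by (simp add: b'_def hom_add algebra_simps)
  qed
  moreover have "norm (b' l - b l) \<le> \<epsilon>" if "l < n" for l
    using r(2)[of l] that by (simp add: b'_def b0_def)
  moreover have "norm (\<pi> (b' n) - y n) \<le> \<epsilon>"
    using order_trans[OF norm_le r(2)[of n]] by (simp add: b'_def hom_add b0n)
  ultimately show ?thesis
    using a(1) p'(1) by (intro exI[of _ a'] exI[of _ b'])
      (auto simp: a'_def intro: selfadjoint_add nonneg_selfadjoint)
qed

text \<open>Listing each \<open>y l\<close> infinitely often makes the error in \<open>z \<le> y l\<close> arbitrarily small.\<close>

lemma interpolation:
  fixes x y :: "nat \<Rightarrow> 'q"
  assumes complete: "seq_monotone_complete TYPE('a)"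
    and sa: "selfadjoint (x 0)" and inc: "\<And>n. nonneg (x (Suc n) - x n)"
    and le: "\<And>n l. nonneg (y l - x n)"
  shows "\<exists>z. \<forall>n l. nonneg (z - x n) \<and> nonneg (y l - z)"
proof -
  define yy where "yy l = y (fst (prod_decode l))" for l
  define Inv where "Inv n ab \<longleftrightarrow> (case ab of (a, b) \<Rightarrow> selfadjoint a \<and> \<pi> a = x n \<and>
    (\<forall>l<n. nonneg (b l - a) \<and> nonneg (\<pi> (b l) - yy l)))" for n :: nat and ab :: "'a \<times> (nat \<Rightarrow> 'a)"
  define Step where "Step n ab ab' \<longleftrightarrow> (case ab of (a, b) \<Rightarrow> case ab' of (a', b') \<Rightarrow> nonneg (a' - a) \<and>
    (\<forall>l<n. norm (b' l - b l) \<le> (1/2)^n) \<and> norm (\<pi> (b' n) - yy n) \<le> (1/2)^n)"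
    for n :: nat and ab ab' :: "'a \<times> (nat \<Rightarrow> 'a)"
  have "\<exists>f. \<forall>n. Inv n (f n) \<and> Step n (f n) (f (Suc n))"
  proof (rule dependent_nat_choice)
    show "\<exists>ab. Inv 0 ab"
      using lift_selfadjoint[OF sa] by (auto simp: Inv_def)
    fix ab n assume "Inv n ab"
    then obtain a b where ab: "ab = (a, b)" "selfadjoint a" "\<pi> a = x n"
      "\<And>l. l < n \<Longrightarrow> nonneg (b l - a)" "\<And>l. l < n \<Longrightarrow> nonneg (\<pi> (b l) - yy l)"
      by (auto simp: Inv_def)
    have "\<exists>a' b'. selfadjoint a' \<and> \<pi> a' = x (Suc n) \<and> nonneg (a' - a) \<and>
      (\<forall>l\<le>n. nonneg (b' l - a') \<and> nonneg (\<pi> (b' l) - yy l)) \<and>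
      (\<forall>l<n. norm (b' l - b l) \<le> (1/2)^n) \<and> norm (\<pi> (b' n) - yy n) \<le> (1/2)^n"
      by (rule interpolation_step[OF inc _ _ ab(2-5)]) (use le in \<open>auto simp: yy_def\<close>)
    then obtain a' b' where "selfadjoint a'" "\<pi> a' = x (Suc n)" "nonneg (a' - a)"
      "\<forall>l\<le>n. nonneg (b' l - a') \<and> nonneg (\<pi> (b' l) - yy l)"
      "\<forall>l<n. norm (b' l - b l) \<le> (1/2)^n" "norm (\<pi> (b' n) - yy n) \<le> (1/2)^n"
      by blast
    then show "\<exists>ab'. Inv (Suc n) ab' \<and> Step n ab ab'"
      by (intro exI[of _ "(a', b')"]) (simp add: Inv_def Step_def ab(1) less_Suc_eq_le)
  qed
  then obtain f where f: "\<And>n. Inv n (f n)" "\<And>n. Step n (f n) (f (Suc n))"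
    by blast
  define a b where "a n = fst (f n)" and "b n = snd (f n)" for n
  have a: "selfadjoint (a n)" "\<pi> (a n) = x n" and b: "\<And>l. l < n \<Longrightarrow> nonneg (b n l - a n)" for n
    using f(1)[of n] by (auto simp: Inv_def a_def b_def split: prod.splits)
  have a_inc: "nonneg (a (Suc n) - a n)" and b_inc: "\<And>l. l < n \<Longrightarrow> norm (b (Suc n) l - b n l) \<le> (1/2)^n"
    and b_yy: "norm (\<pi> (b (Suc n) n) - yy n) \<le> (1/2)^n" for n
    using f(2)[of n] by (auto simp: Step_def a_def b_def split: prod.splits)
  have a_mono: "nonneg (a (n + m) - a n)" for n m
  proof (induction m)
    case (Suc m)
    from nonneg_add[OF Suc a_inc[of "n + m"]] show ?case by simp
  qed simp
  \<comment> \<open>The lift with index \<open>l\<close> exists only from stage \<open>Suc l\<close>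
    on. From there its increments sum to at most 2 (1/2)^(l + 1), a bound that shrinks for late
    indices.\<close>
  have "\<exists>L. (\<lambda>n. b (n + Suc l) l) \<longlonglongrightarrow> L \<and> norm (L - b (0 + Suc l) l) \<le> 2 * (1/2)^Suc l" for l
  proof (rule geometric_increments_limit)
    show "norm (b (Suc n + Suc l) l - b (n + Suc l) l) \<le> (1/2)^Suc l * (1/2)^n" for n
      using b_inc[of l "n + Suc l"] by (simp add: power_add mult.commute)
  qed
  then obtain L where L: "\<And>l. (\<lambda>n. b (n + Suc l) l) \<longlonglongrightarrow> L l"
    "\<And>l. norm (L l - b (Suc l) l) \<le> 2 * (1/2)^Suc l"
    by (metis add_0)
  have aL: "nonneg (L l - a m)" for l m
  proof (rule nonneg_limit)
    show "(\<lambda>n. b ((n + m) + Suc l) l - a m) \<longlonglongrightarrow> L l - a m"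
      by (intro tendsto_diff tendsto_const LIMSEQ_ignore_initial_segment[OF L(1)])
    show "nonneg (b ((n + m) + Suc l) l - a m)" for n
      using nonneg_add[OF b[of l "(n + m) + Suc l"] a_mono[of m "n + Suc l"]]
      by (simp add: algebra_simps)
  qed
  have "norm (a n) \<le> norm (a 0) + norm (L 0 - a 0)" for n
  proof -
    have "norm (a n - a 0) \<le> norm (L 0 - a 0)"
      using a_mono[of 0 n] aL[of 0 n] by (intro nonneg_norm_mono) auto
    then show ?thesis
      using norm_triangle_ineq[of "a 0" "a n - a 0"] by simp
  qed
  then have "bounded (range a)"
    by (auto simp: bounded_iff)
  then have "bounded_increasing_sa a"
    using a a_inc by (simp add: bounded_increasing_sa_def cstar_le_def cstar_pos_iff_nonneg)
  with complete obtain s where "is_sa_lub a s"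
    by (auto simp: seq_monotone_complete_def)
  moreover have "selfadjoint (L l)" for l
    using selfadjoint_add[OF nonneg_selfadjoint[OF aL[of l 0]] a(1)[of 0]] by simp
  ultimately have s: "nonneg (s - a n)" "nonneg (L l - s)" for n l
    using aL by (auto simp: is_sa_lub_def cstar_le_def cstar_pos_iff_nonneg)
  have "nonneg (y l - \<pi> s)" for l
  proof (rule nonneg_limit)
    \<comment> \<open>The k-th copy of \<open>y l\<close> has index at least k, so both its initial
      error and its later drift are at most (1/2)^k.\<close>
    define i where "i k = prod_encode (l, k)" for k
    show "nonneg (\<pi> (L (i k)) - \<pi> s)" for k
      using hom_nonneg[OF s(2)] by (simp add: hom_diff)
    have err: "norm (\<pi> (L (i k)) - y l) \<le> 2 * (1/2)^k" for k
    proof -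
      have "norm (\<pi> (L (i k)) - y l) \<le> norm (\<pi> (L (i k) - b (Suc (i k)) (i k))) +
          norm (\<pi> (b (Suc (i k)) (i k)) - yy (i k))"
        using norm_triangle_ineq[of "\<pi> (L (i k) - b (Suc (i k)) (i k))" "\<pi> (b (Suc (i k)) (i k)) - yy (i k)"]
        by (simp add: hom_diff) (simp add: yy_def i_def)
      also have "\<dots> \<le> (1/2)^i k + (1/2)^i k"
        using order_trans[OF norm_le L(2)[of "i k"]] b_yy[of "i k"] by (intro add_mono) auto
      also have "\<dots> \<le> 2 * (1/2)^k"
        using power_decreasing[of k "i k" "1/2::real"] le_prod_encode_2[of k l] by (simp add: i_def)
      finally show ?thesis .
    qed
    have "(\<lambda>k. 2 * (1/2::real)^k) \<longlonglongrightarrow> 0"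
      by (rule tendsto_mult_right_zero) (simp add: LIMSEQ_realpow_zero)
    from Lim_null_comparison[OF always_eventually[OF allI[OF err]] this]
    have "(\<lambda>k. \<pi> (L (i k)) - y l) \<longlonglongrightarrow> 0" .
    then have "(\<lambda>k. \<pi> (L (i k))) \<longlonglongrightarrow> y l"
      by (simp only: LIM_zero_iff)
    then show "(\<lambda>k. \<pi> (L (i k)) - \<pi> s) \<longlonglongrightarrow> y l - \<pi> s"
      by (intro tendsto_diff tendsto_const)
  qed
  moreover have "nonneg (\<pi> s - x n)" for n
    using hom_nonneg[OF s(1)[of n]] by (simp add: hom_diff a(2))
  ultimately show ?thesis by blast
qed

end

section \<open>Upper bounds of bounded sequences in the quotient\<close>

context cstar_quotient
begin

text \<open>Without a unit, a bounded sequence in the quotient need not obviously have an upper bound; here one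
  comes from the supremum of an approximate unit for lifts of all its terms.\<close>

lemma upper_bound:
  fixes x :: "nat \<Rightarrow> 'q"
  assumes complete: "seq_monotone_complete TYPE('a)"
    and sa: "\<And>n. selfadjoint (x n)" and bdd: "bounded (range x)"
  shows "\<exists>u. selfadjoint u \<and> (\<forall>n. nonneg (u - x n))"
proof -
  have "\<exists>c. \<forall>n. selfadjoint (c n) \<and> \<pi> (c n) = x n"
    using lift_selfadjoint[OF sa] by metis
  then obtain c where c: "\<And>n. selfadjoint (c n)" "\<And>n. \<pi> (c n) = x n"
    by blast
  have sc: "star (c n) = c n" for n
    using c(1) by (simp add: selfadjoint_def)
  \<comment> \<open>The weights make the sum H of all \<open>w n\<close> (c n)^2 converge with norm
    at most 1, while (c n)^2 \<le> H/\<open>w n\<close> keeps every \<open>c n\<close> controlled by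
    H.\<close>
  define w where "w n = (1/2)^Suc n / (1 + (norm (c n))\<^sup>2)" for n
  have w: "0 < w n" for n
    by (simp add: w_def add_pos_nonneg)
  define d where "d n = w n *\<^sub>R (c n * c n)" for n
  have d: "nonneg (d n)" for n
    unfolding d_def using w c(1) by (intro nonneg_scaleR nonneg_square)
  have nd: "norm (d n) \<le> (1/2)^Suc n" for n
  proof -
    have "norm (d n) = w n * (norm (c n))\<^sup>2"
      using w[of n] by (simp add: d_def norm_selfadjoint_square c(1))
    also have "\<dots> = (1/2)^Suc n * ((norm (c n))\<^sup>2 / (1 + (norm (c n))\<^sup>2))"
      by (simp add: w_def)
    also have "\<dots> \<le> (1/2)^Suc n * 1"
      by (intro mult_left_mono) (simp_all add: divide_le_eq_1 add_pos_nonneg)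
    finally show ?thesis by simp
  qed
  have "(\<lambda>n. (1/2::real)^Suc n) sums 1"
    by (rule power_half_series)
  then have sum1: "summable (\<lambda>n. (1/2::real)^Suc n)" "(\<Sum>n. (1/2::real)^Suc n) = 1"
    by (auto simp only: sums_iff)
  have nsum: "summable (\<lambda>n. norm (d n))"
    by (rule summable_comparison_test'[OF sum1(1), of 0]) (use nd in simp)
  define H where "H = (\<Sum>n. d n)"
  have lim: "(\<lambda>m. \<Sum>i<m. d i) \<longlonglongrightarrow> H"
    unfolding H_def by (rule summable_LIMSEQ[OF summable_norm_cancel[OF nsum]])
  have H: "nonneg H"
    using lim by (rule nonneg_limit) (intro nonneg_sum d)
  have "norm H \<le> (\<Sum>n. (1/2::real)^Suc n)"
    unfolding H_def by (rule order_trans[OF summable_norm[OF nsum] suminf_le[OF nd nsum sum1(1)]])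
  then have nH: "norm H \<le> 1"
    by (simp only: sum1(2))
  have Hd: "nonneg (H - d n)" for n
  proof (rule nonneg_limit)
    show "(\<lambda>m. (\<Sum>i<m + Suc n. d i) - d n) \<longlonglongrightarrow> H - d n"
      by (intro tendsto_diff tendsto_const LIMSEQ_ignore_initial_segment[OF lim])
    show "nonneg ((\<Sum>i<m + Suc n. d i) - d n)" for m
    proof -
      have "(\<Sum>i<m + Suc n. d i) - d n = (\<Sum>i\<in>{..<m + Suc n} - {n}. d i)"
        by (subst sum_diff1) auto
      then show ?thesis
        by (simp only: nonneg_sum d)
    qed
  qed
  define e where "e = approx_unit H"
  have e: "nonneg (e k)" "norm (e k) \<le> 2" for k
    unfolding e_def using H nH by (rule nonneg_approx_unit, rule norm_approx_unit_le)
  have se: "star (e k) = e k" for k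
    using nonneg_selfadjoint[OF e(1)] by (simp add: selfadjoint_def)
  have "bounded (range e)"
    using e(2) by (auto simp: bounded_iff)
  moreover have "nonneg (e (Suc k) - e k)" for k
    unfolding e_def using H nH by (rule approx_unit_mono)
  ultimately have "bounded_increasing_sa e"
    by (simp add: bounded_increasing_sa_def cstar_le_def cstar_pos_iff_nonneg nonneg_selfadjoint e(1))
  with complete obtain s where "is_sa_lub e s"
    by (auto simp: seq_monotone_complete_def)
  then have s: "selfadjoint s" "nonneg (s - e k)" for k
    by (auto simp: is_sa_lub_def cstar_le_def cstar_pos_iff_nonneg)
  obtain M where M: "0 < M" "\<And>n. norm (x n) \<le> M"
    using bdd by (auto simp: bounded_pos)
  \<comment> \<open>In the quotient e x e \<le> M e^2 \<le> 2 M e \<le> 2 M s for each unit e, and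
    the elements e x e tend to x. The 2 is the norm bound of e.\<close>
  have "nonneg ((2 * M) *\<^sub>R \<pi> s - x n)" for n
  proof (rule nonneg_limit)
    have "nonneg ((1 / w n) *\<^sub>R (H - d n))"
      using w Hd by (intro nonneg_scaleR) auto
    then have "nonneg ((1 / w n) *\<^sub>R H - star (c n) * c n)"
      using w[of n] by (simp add: d_def sc scaleR_diff_right)
    from approx_unit_tendsto[OF H nH this] have "(\<lambda>k. c n - c n * e k) \<longlonglongrightarrow> 0"
      by (simp add: e_def)
    then have lim3: "(\<lambda>k. 3 * norm (c n - c n * e k)) \<longlonglongrightarrow> 0"
      by (intro tendsto_mult_right_zero tendsto_norm_zero)
    have err: "norm (\<pi> (e k * c n * e k) - x n) \<le> 3 * norm (c n - c n * e k)" for k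
    proof -
      have "star (c n - c n * e k) = c n - e k * c n"
        by (simp add: sc se)
      then have "norm (c n - e k * c n) = norm (c n - c n * e k)"
        by (metis norm_star)
      moreover have "norm (e k * (c n - c n * e k)) \<le> 2 * norm (c n - c n * e k)"
        using e(2) by (intro order_trans[OF norm_mult_ineq] mult_right_mono) auto
      moreover have "e k * c n * e k - c n = - (c n - e k * c n) - e k * (c n - c n * e k)"
        by (simp add: algebra_simps)
      then have "norm (e k * c n * e k - c n) \<le> norm (c n - e k * c n) + norm (e k * (c n - c n * e k))"
        by (metis norm_minus_cancel norm_triangle_ineq4)
      moreover have "norm (\<pi> (e k * c n * e k) - x n) \<le> norm (e k * c n * e k - c n)"
        using norm_le[of "e k * c n * e k - c n"] by (simp add: hom_diff c(2))
      ultimately show ?thesis by simp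
    qed
    from Lim_null_comparison[OF always_eventually[OF allI[OF err]] lim3]
    have "(\<lambda>k. \<pi> (e k * c n * e k)) \<longlonglongrightarrow> x n"
      by (simp only: LIM_zero_iff)
    then show "(\<lambda>k. (2 * M) *\<^sub>R \<pi> s - \<pi> (e k * c n * e k)) \<longlonglongrightarrow> (2 * M) *\<^sub>R \<pi> s - x n"
      by (intro tendsto_diff tendsto_const)
    show "nonneg ((2 * M) *\<^sub>R \<pi> s - \<pi> (e k * c n * e k))" for k
    proof -
      obtain r where r: "selfadjoint r" "r * r = e k"
        using e(1) by (blast dest: nonneg_root)
      have "nonneg (2 *\<^sub>R (star r * r) - star r * e k * r)"
        using e by (intro nonneg_norm_conj) (auto simp: nonneg_selfadjoint)
      then have "nonneg (2 *\<^sub>R e k - e k * e k)"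
        using r(1) by (simp add: selfadjoint_def mult.assoc flip: r(2))
      then have "nonneg (M *\<^sub>R \<pi> (2 *\<^sub>R e k - e k * e k) + (2 * M) *\<^sub>R \<pi> (s - e k) +
          (M *\<^sub>R (star (\<pi> (e k)) * \<pi> (e k)) - star (\<pi> (e k)) * x n * \<pi> (e k)))"
        using s M sa by (intro nonneg_add nonneg_scaleR nonneg_norm_conj hom_nonneg) auto
      also have "\<dots> = (2 * M) *\<^sub>R \<pi> s - \<pi> (e k * c n * e k)"
        by (simp add: hom_add hom_mult hom_diff hom_scaleR c(2) se scaleR_2 algebra_simps flip: hom_star)
          (simp add: scaleR_2 scaleR_add_right flip: scaleR_scaleR)
      finally show ?thesis .
    qed
  qed
  moreover have "selfadjoint ((2 * M) *\<^sub>R \<pi> s)"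
    using s(1) by (simp add: selfadjoint_def flip: hom_star)
  ultimately show ?thesis by blast
qed

end

section \<open>From the coset model to a quotient map\<close>

lemma quot_iso_cstar_quotient:
  fixes \<phi> :: "'q::cstar_algebra \<Rightarrow> 'a::cstar_algebra set"
  assumes ideal: "closed_ideal J" and iso: "quot_iso J \<phi>"
  shows "\<exists>\<pi> :: 'a \<Rightarrow> 'q. cstar_quotient J \<pi>"
proof -
  have J: "0 \<in> J" "\<And>x y. x \<in> J \<Longrightarrow> y \<in> J \<Longrightarrow> x + y \<in> J" "\<And>c x. x \<in> J \<Longrightarrow> c *\<^sub>C x \<in> J"
    "\<And>a x. x \<in> J \<Longrightarrow> a * x \<in> J" "\<And>a x. x \<in> J \<Longrightarrow> x * a \<in> J"
    using ideal by (auto simp: closed_ideal_def)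
  have minus: "- x \<in> J" if "x \<in> J" for x
    using J(3)[OF that, of "complex_of_real (-1)"] by (simp only: scaleR_scaleC[symmetric]) simp
  have coset_eq: "a +o J = b +o J \<longleftrightarrow> a - b \<in> J" for a b
  proof
    assume "a +o J = b +o J"
    then have "a \<in> b +o J"
      using J(1) by (force simp: elt_set_plus_def)
    then show "a - b \<in> J"
      by (auto simp: elt_set_plus_def)
  next
    have sub: "u +o J \<subseteq> v +o J" if "u - v \<in> J" for u v
    proof
      fix x assume "x \<in> u +o J"
      then obtain j where "j \<in> J" "x = u + j"
        by (auto simp: elt_set_plus_def)
      then have "x = v + ((u - v) + j)" "(u - v) + j \<in> J"
        using J(2)[OF that] by simp_all
      then show "x \<in> v +o J"
        unfolding elt_set_plus_def by blast
    qed
    assume "a - b \<in> J"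
    with minus[OF this] show "a +o J = b +o J"
      by (intro equalityI sub) simp_all
  qed
  have self: "a \<in> a +o J" for a
    using J(1) by (force simp: elt_set_plus_def)
  have mem: "u - a \<in> J" if "u \<in> a +o J" for u a
    using that by (auto simp: elt_set_plus_def)
  have q_add: "quot_add J (a +o J) (b +o J) = (a + b) +o J" for a b
  proof -
    have "(u + v) +o J = (a + b) +o J" if "u \<in> a +o J" "v \<in> b +o J" for u v
      using J(2)[OF mem[OF that(1)] mem[OF that(2)]] by (simp add: coset_eq algebra_simps)
    with self show ?thesis unfolding quot_add_def by blast
  qed
  have q_mult: "quot_mult J (a +o J) (b +o J) = (a * b) +o J" for a b
  proof -
    have "(u * v) +o J = (a * b) +o J" if "u \<in> a +o J" "v \<in> b +o J" for u v
      using J(2)[OF J(5)[OF mem[OF that(1)], of v] J(4)[OF mem[OF that(2)], of a]]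
      by (simp add: coset_eq algebra_simps)
    with self show ?thesis unfolding quot_mult_def by blast
  qed
  have q_scaleC: "quot_scaleC J c (a +o J) = (c *\<^sub>C a) +o J" for c a
  proof -
    have "(c *\<^sub>C u) +o J = (c *\<^sub>C a) +o J" if "u \<in> a +o J" for u
      using J(3)[OF mem[OF that], of c] by (simp add: coset_eq scaleC_diff_right)
    with self show ?thesis unfolding quot_scaleC_def by blast
  qed
  have bij: "bij_betw \<phi> UNIV (quot_carrier J)"
    and h_add: "\<And>p q. \<phi> (p + q) = quot_add J (\<phi> p) (\<phi> q)"
    and h_mult: "\<And>p q. \<phi> (p * q) = quot_mult J (\<phi> p) (\<phi> q)"
    and h_scaleC: "\<And>c q. \<phi> (c *\<^sub>C q) = quot_scaleC J c (\<phi> q)"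
    and h_star: "\<And>q. \<phi> (star q) = quot_star J (\<phi> q)"
    and h_norm: "\<And>q. norm q = quot_norm (\<phi> q)"
    using iso by (auto simp: quot_iso_def)
  define \<pi> where "\<pi> a = inv \<phi> (a +o J)" for a
  have "range \<phi> = quot_carrier J" and inj: "inj \<phi>"
    using bij by (auto simp: bij_betw_def)
  then have \<pi>: "\<phi> (\<pi> a) = a +o J" for a
    unfolding \<pi>_def by (intro f_inv_into_f) (auto simp: quot_carrier_def)
  have surj: "\<exists>a. q = \<pi> a" for q
  proof -
    have "\<phi> q \<in> quot_carrier J"
      using \<open>range \<phi> = quot_carrier J\<close> by blast
    then obtain a where "\<phi> q = a +o J"
      by (auto simp: quot_carrier_def)
    with \<pi>[of a] inj show ?thesis
      by (metis injD)
  qed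
  have eqI: "p = q" if "\<phi> p = \<phi> q" for p q
    using inj that by (rule injD)
  have add: "\<pi> (a + b) = \<pi> a + \<pi> b" for a b
    by (rule eqI) (simp add: h_add \<pi> q_add)
  have "\<pi> 0 = 0"
    using add[of 0 0] by simp
  then have \<phi>0: "\<phi> 0 = 0 +o J"
    using \<pi>[of 0] by simp
  \<comment> \<open>That J is closed under \<open>star\<close> comes from \<open>\<phi>\<close>
    itself: as \<open>star 0 = 0\<close>, the union of all cosets of \<open>star u\<close> with u in
    J must be the single coset J.\<close>
  have star_J: "star u \<in> J" if "u \<in> J" for u
  proof -
    have "u \<in> 0 +o J" using that by (simp add: elt_set_plus_def)
    then have "star u \<in> quot_star J (0 +o J)"
      unfolding quot_star_def using self by blast
    also have "quot_star J (0 +o J) = 0 +o J"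
      using h_star[of 0] by (simp add: \<phi>0)
    finally show ?thesis
      by (simp add: elt_set_plus_def)
  qed
  have q_star: "quot_star J (a +o J) = star a +o J" for a
  proof -
    have "star u +o J = star a +o J" if "u \<in> a +o J" for u
      using star_J[OF mem[OF that]] by (simp add: coset_eq)
    with self show ?thesis unfolding quot_star_def by blast
  qed
  have "cstar_quotient J \<pi>"
  proof
    show "closed_ideal J" by (rule ideal)
    show "\<pi> (a + b) = \<pi> a + \<pi> b" for a b by (rule add)
    show "\<pi> (a * b) = \<pi> a * \<pi> b" for a b
      by (rule eqI) (simp add: h_mult \<pi> q_mult)
    show "\<pi> (c *\<^sub>C a) = c *\<^sub>C \<pi> a" for c a
      by (rule eqI) (simp add: h_scaleC \<pi> q_scaleC)
    show "\<pi> (star a) = star (\<pi> a)" for a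
      by (rule eqI) (simp add: h_star \<pi> q_star)
    show "norm (\<pi> a) \<le> norm a" for a
      unfolding h_norm \<pi> quot_norm_def by (rule cINF_lower[OF bdd_belowI2[of _ 0] self]) simp
    show "surj \<pi>"
      using surj by (auto simp: surj_def)
    show "\<pi> a = 0 \<longleftrightarrow> a \<in> J" for a
      using coset_eq[of a 0] by (metis \<pi> \<phi>0 diff_zero eqI)
  qed
  then show ?thesis by (rule exI[where x = \<pi>])
qed

section \<open>Representations on a separable Hilbert space\<close>

text \<open>Polarization reduces the continuity of quadratic forms to that of the norm.\<close>

lemma Re_cinner_eq_norm: "Re (cinner x y) = ((norm (x + y))\<^sup>2 - (norm (x - y))\<^sup>2) / 4"
  for x y :: "'h::chilbert_space"
proof -
  have left: "cinner (a + b) c = cinner a c + cinner b c" for a b c :: 'h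
    by (metis cinner_add_right cinner_commute complex_cnj_add)
  have "(-1) *\<^sub>C y = - y"
    using scaleR_scaleC[of "-1" y] by simp
  then have mr: "cinner z (- y) = - cinner z y" for z
    using cinner_scaleC_right[of z "-1" y] by simp
  have ml: "cinner (- y) z = - cinner y z" for z
    by (metis mr cinner_commute complex_cnj_minus)
  have Re_sym: "Re (cinner y x) = Re (cinner x y)"
    using cinner_commute[of y x] by simp
  have Re_self: "Re (cinner a a) = (norm a)\<^sup>2" for a :: 'h
    by (simp add: cinner_self)
  have "Re (cinner (x + y) (x + y)) = Re (cinner x x) + Re (cinner y y) + 2 * Re (cinner x y)"
    by (simp add: left cinner_add_right Re_sym)
  moreover have "Re (cinner (x + - y) (x + - y)) = Re (cinner x x) + Re (cinner y y) - 2 * Re (cinner x y)"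
    by (simp only: left cinner_add_right mr ml) (simp add: Re_sym)
  ultimately show ?thesis
    by (simp add: Re_self)
qed

lemma continuous_on_Re_cinner:
  "continuous_on UNIV (\<lambda>h :: 'h::chilbert_space. Re (cinner h (blinfun_apply T h)))"
  unfolding Re_cinner_eq_norm by (intro continuous_intros) auto

lemma operator_le_iff:
  fixes S T :: "'h::chilbert_space \<Rightarrow>\<^sub>L 'h"
  assumes "S \<in> sa_operators" "T \<in> sa_operators"
  shows "operator_le S T \<longleftrightarrow> (\<forall>h. Re (cinner h (blinfun_apply S h)) \<le> Re (cinner h (blinfun_apply T h)))"
proof -
  have Im: "Im (cinner h (blinfun_apply A h)) = 0" if "A \<in> sa_operators" for A :: "'h \<Rightarrow>\<^sub>L 'h" and h
  proof -
    have "cinner h (blinfun_apply A h) = cnj (cinner h (blinfun_apply A h))"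
      using that cinner_commute[of h "blinfun_apply A h"] by (simp add: sa_operators_def)
    from arg_cong[OF this, of Im] show ?thesis by simp
  qed
  have "cinner h (blinfun_apply (T - S) h) + cinner h (blinfun_apply S h) = cinner h (blinfun_apply T h)" for h
    by (simp add: blinfun.diff_left flip: cinner_add_right)
  then have "cinner h (blinfun_apply (T - S) h) = cinner h (blinfun_apply T h) - cinner h (blinfun_apply S h)" for h
    by (metis add_diff_cancel_right')
  then show ?thesis
    using assms by (simp add: operator_le_def complex_nonneg_Reals_iff Im)
qed

text \<open>For each point of a dense set and each rational, one function of the family whose value there lies
  below that rational.\<close>

lemma countable_subfamily_same_lower_bounds:
  fixes F :: "'i \<Rightarrow> 'h::topological_space \<Rightarrow> real"
  assumes D: "countable (D :: 'h set)" "closure D = UNIV"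
    and cont: "\<And>i. i \<in> I \<Longrightarrow> continuous_on UNIV (F i)"
  shows "\<exists>K\<subseteq>I. countable K \<and> (\<forall>g. continuous_on UNIV g \<longrightarrow>
    (\<forall>k\<in>K. \<forall>h. g h \<le> F k h) \<longrightarrow> (\<forall>i\<in>I. \<forall>h. g h \<le> F i h))"
proof -
  define P where "P = {(d, r). d \<in> D \<and> r \<in> \<rat> \<and> (\<exists>i\<in>I. F i d < r)}"
  have "\<forall>p\<in>P. \<exists>i\<in>I. F i (fst p) < snd p"
    by (auto simp: P_def)
  then obtain k where k: "\<And>p. p \<in> P \<Longrightarrow> k p \<in> I" "\<And>p. p \<in> P \<Longrightarrow> F (k p) (fst p) < snd p"
    by metis
  have "P \<subseteq> D \<times> \<rat>"
    by (auto simp: P_def)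
  then have "countable P"
    using D(1) countable_rat by (meson countable_SIGMA countable_subset)
  moreover have "g h \<le> F i h" if g: "continuous_on UNIV g" "\<forall>j\<in>k ` P. \<forall>h. g h \<le> F j h" and i: "i \<in> I" for g i h
  proof (rule ccontr)
    assume "\<not> g h \<le> F i h"
    then have "h \<in> {h. F i h < g h}" by simp
    moreover have "open {h. F i h < g h}"
      using cont[OF i] g(1) by (rule open_Collect_less)
    ultimately have "{h. F i h < g h} \<inter> D \<noteq> {}"
      using D(2) open_Int_closure_eq_empty[of "{h. F i h < g h}" D] by auto
    then obtain d where d: "d \<in> D" "F i d < g d" by blast
    then obtain r where r: "r \<in> \<rat>" "F i d < r" "r < g d"
      using Rats_dense_in_real by blast
    then have "(d, r) \<in> P"
      using d i by (auto simp: P_def)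
    with g(2) have "g d \<le> F (k (d, r)) d"
      by blast
    with k(2)[OF \<open>(d, r) \<in> P\<close>] r(3) show False
      by simp
  qed
  ultimately show ?thesis
    using k(1) by (intro exI[of _ "k ` P"]) blast
qed

theorem theorem3:
  fixes J :: "'a::cstar_algebra set"
    and \<phi> :: "'q::cstar_algebra \<Rightarrow> 'a set"
  assumes "seq_monotone_complete TYPE('a)"
    and "closed_ideal J"
    and "quot_iso J \<phi>"
  shows "(\<forall>(x :: nat \<Rightarrow> 'q) (y :: nat \<Rightarrow> 'q).
            bounded_increasing_sa x \<and> (\<forall>n l. x n \<sqsubseteq> y l) \<longrightarrow>
            (\<exists>z. \<forall>n l. x n \<sqsubseteq> x (Suc n) \<and> x n \<sqsubseteq> z \<and> z \<sqsubseteq> y l)) \<and>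
         (separable_space (euclidean :: 'h::chilbert_space topology) \<and>
          (\<exists>\<iota> :: 'q \<Rightarrow> ('h \<Rightarrow>\<^sub>L 'h). order_isomorphic_rep \<iota>) \<longrightarrow>
          seq_monotone_complete TYPE('q))"
proof (intro conjI allI impI)
  obtain \<pi> where "cstar_quotient J (\<pi> :: 'a \<Rightarrow> 'q)"
    using quot_iso_cstar_quotient[OF assms(2,3)] by blast
  then interpret cstar_quotient J \<pi> .
  have le_iff: "u \<sqsubseteq> v \<longleftrightarrow> nonneg (v - u)" for u v :: 'q
    by (simp add: cstar_le_def cstar_pos_iff_nonneg)
  have inter: "\<exists>z. \<forall>n l. x n \<sqsubseteq> z \<and> z \<sqsubseteq> y l"
    if "bounded_increasing_sa x" "\<And>n l. x n \<sqsubseteq> y l" for x y :: "nat \<Rightarrow> 'q"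
    using interpolation[OF assms(1), of x y] that by (simp add: bounded_increasing_sa_def le_iff)
  show "\<exists>z. \<forall>n l. x n \<sqsubseteq> x (Suc n) \<and> x n \<sqsubseteq> z \<and> z \<sqsubseteq> y l"
    if "bounded_increasing_sa x \<and> (\<forall>n l. x n \<sqsubseteq> y l)" for x y :: "nat \<Rightarrow> 'q"
    using inter[of x y] that by (auto simp: bounded_increasing_sa_def)
  assume "separable_space (euclidean :: 'h topology) \<and> (\<exists>\<iota> :: 'q \<Rightarrow> ('h \<Rightarrow>\<^sub>L 'h). order_isomorphic_rep \<iota>)"
  then obtain D :: "'h set" and \<iota> :: "'q \<Rightarrow> ('h \<Rightarrow>\<^sub>L 'h)"
    where D: "countable D" "closure D = UNIV" and \<iota>: "order_isomorphic_rep \<iota>"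
    by (auto simp: separable_space_def)
  define F where "F u h = Re (cinner h (blinfun_apply (\<iota> u) h))" for u h
  have F: "u \<sqsubseteq> v \<longleftrightarrow> (\<forall>h. F u h \<le> F v h)" if "selfadjoint u" "selfadjoint v" for u v
    using \<iota> that by (simp add: order_isomorphic_rep_def F_def operator_le_iff)
  have cont: "continuous_on UNIV (F u)" for u
    unfolding F_def by (rule continuous_on_Re_cinner)
  show "seq_monotone_complete TYPE('q)"
    unfolding seq_monotone_complete_def
  proof (intro allI impI)
    fix x :: "nat \<Rightarrow> 'q"
    assume x: "bounded_increasing_sa x"
    define U where "U = {u. selfadjoint u \<and> (\<forall>n. x n \<sqsubseteq> u)}"
    obtain u0 where u0: "u0 \<in> U"
      using upper_bound[OF assms(1), of x] x by (auto simp: U_def bounded_increasing_sa_def le_iff)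
    obtain K where K: "K \<subseteq> U" "countable K"
      "\<And>g. continuous_on UNIV g \<Longrightarrow> \<forall>k\<in>K. \<forall>h. g h \<le> F k h \<Longrightarrow> \<forall>u\<in>U. \<forall>h. g h \<le> F u h"
      using countable_subfamily_same_lower_bounds[OF D, of U F] cont by blast
    \<comment> \<open>Adding \<open>u0\<close> keeps the enumerated set nonempty, so that the range
      of \<open>y\<close> is exactly this set.\<close>
    define y where "y = from_nat_into (insert u0 K)"
    have y: "range y = insert u0 K"
      unfolding y_def using K(2) by (intro range_from_nat_into) auto
    have yU: "y l \<in> U" for l
      using rangeI[of y l] K(1) u0 unfolding y by blast
    then obtain z where z: "\<And>n. x n \<sqsubseteq> z" "\<And>l. z \<sqsubseteq> y l"
      using inter[OF x, of y] by (auto simp: U_def)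
    \<comment> \<open>Interpolation provides \<open>z\<close> by order relations only;
      \<open>y 0\<close> and the positive difference \<open>y 0 - z\<close> are selfadjoint, hence
      so is \<open>z\<close>.\<close>
    have "selfadjoint (y 0 - (y 0 - z))"
      using z(2)[of 0] yU[of 0]
      by (intro selfadjoint_diff[OF _ nonneg_selfadjoint]) (auto simp: U_def le_iff)
    then have sz: "selfadjoint z" by simp
    have "z \<sqsubseteq> k" if "k \<in> K" for k
      using that y z(2) by (metis insertCI rangeE)
    then have "\<forall>k\<in>K. \<forall>h. F z h \<le> F k h"
      using K(1) F[OF sz] unfolding U_def by blast
    from K(3)[OF cont this] have "z \<sqsubseteq> u" if "u \<in> U" for u
      using that F[OF sz] by (auto simp: U_def)
    then show "\<exists>s. is_sa_lub x s"
      using sz z(1) by (auto simp: is_sa_lub_def U_def)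
  qed
qed

end
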